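(* There is a sufficiently large constant $C$ such that $\mathrm{H}_1(\mathrm{BoolSimon}_n \circ \mathrm{Xor}_{C\log n}) = \widetilde{\Omega}(\sqrt{n})$.
   Context: Let $k$ be an integer and $K=2^k$; indices in $\{0,\dots,K-1\}$ are identified with $k$-bit strings and $\oplus$ is bitwise XOR. $\mathrm{Simon}$ is the partial function on strings $x=x_0x_1\dots x_{K-1}$ with $x_i\in\{0,\dots,K-1\}$, defined on those $x$ for which there is some $a$ with: for all $i\ne j$, $x_i=x_j \iff i\oplus j=a$; its value is $\mathrm{Simon}(x)=a$. $\mathrm{LSBSimon}(x)=\mathrm{Simon}(x)\bmod 2$. $\mathrm{BoolSimon}_n$, with $n=Kk$, is the Boolean version of $\mathrm{LSBSimon}$: its input is the binary string of length $Kk$ obtained by writing each $x_i$ in binary with $k$ bits, and its value is $\mathrm{LSBSimon}(x)$ (legal inputs are encodings of legal inputs of $\mathrm{LSBSimon}$). $\mathrm{Xor}_m(y)=y_1\oplus\dots\oplus y_m$. For functions $f$ on $n$ bits and $g$ on $m$ bits, $f\circ g$ on $nm$ bits is $f\circ g(x_{1,1},\dots,x_{n,m})=f(g(x_{1,1},\dots,x_{1,m}),\dots,g(x_{n,1},\dots,x_{n,m}))$, defined whenever this makes sense. A quantum decision tree making $t$ queries is specified by unitaries $U_0,\dots,U_t$ and outputs the result of measuring $U_tO_xU_{t-1}O_x\cdots O_xU_0|0\rangle|0\rangle|0\rangle$ in the computational basis, where $O_x|i\rangle|b\rangle|w\rangle=|i\rangle|b\oplus x_i\rangle|w\rangle$.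 A hybrid decision tree $T$ is a rooted tree where each internal node $v$ carries a quantum decision tree $\mathcal{A}_v$, whose possible outputs are in one-to-one correspondence with the children of $v$; leaves are labeled with output values. On input $x$, starting from the root one runs $\mathcal{A}_v(x)$, moves to the child corresponding to its output, and repeats until reaching a leaf, whose label is the output. The cost of a root-to-leaf path is the sum of the query counts of the $\mathcal{A}_v$ on it, and the cost of $T$ is the maximum cost of a root-to-leaf path. $T$ is $q$-limited if every $\mathcal{A}_v$ makes at most $q$ queries. $T$ computes a partial function $f:D\to\{0,1\}$ if for every $x\in D$ it outputs $f(x)$ with probability at least $2/3$. $\mathrm{H}_q(f)$ is the minimal cost of a $q$-limited hybrid decision tree computing $f$. $\widetilde{\Omega}(g)$ means $\Omega(g/\mathrm{polylog}\, g)$. *)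

theory Defs
  imports
    Complex_Main
    "HOL-Library.Landau_Symbols"
    "Jordan_Normal_Form.Schur_Decomposition"
begin

section \<open>Partial functions on strings\<close>

definition simon_witness :: "nat \<Rightarrow> nat list \<Rightarrow> nat \<Rightarrow> bool" where
  "simon_witness k xs a \<longleftrightarrow>
     length xs = 2 ^ k \<and> (\<forall>i<2 ^ k. xs ! i < 2 ^ k) \<and> a < 2 ^ k \<and>
     (\<forall>i<2 ^ k. \<forall>j<2 ^ k. i \<noteq> j \<longrightarrow> (xs ! i = xs ! j \<longleftrightarrow> Bit_Operations.xor i j = a))"

definition simon :: "nat \<Rightarrow> nat list \<rightharpoonup> nat" where
  "simon k xs = (if \<exists>a. simon_witness k xs a then Some (THE a. simon_witness k xs a) else None)"

lemma simon_witness_unique: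
  assumes "simon_witness k xs a" "simon_witness k xs b"
  shows "a = b"
proof -
  have imp: "a = b" if A: "simon_witness k xs a" and B: "simon_witness k xs b" and "a \<noteq> 0" for a b
  proof -
    have "a < 2 ^ k" "a \<noteq> 0" "(0::nat) < 2 ^ k" using A that(3) by (auto simp: simon_witness_def)
    then have "xs ! 0 = xs ! a" using A unfolding simon_witness_def by auto
    then have "Bit_Operations.xor 0 a = b" using B \<open>a < 2 ^ k\<close> \<open>a \<noteq> 0\<close> \<open>(0::nat) < 2 ^ k\<close>
      unfolding simon_witness_def by metis
    then show ?thesis by simp
  qed
  show ?thesis using imp[OF assms] imp[OF assms(2,1)] by metis
qed

lemma simon_eq: "simon_witness k xs a \<Longrightarrow> simon k xs = Some a"
  unfolding simon_def using simon_witness_unique by (auto intro!: the_equality)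

definition lsb_simon :: "nat \<Rightarrow> nat list \<rightharpoonup> nat" where
  "lsb_simon k xs = map_option (\<lambda>a. a mod 2) (simon k xs)"

definition block :: "nat \<Rightarrow> nat \<Rightarrow> 'a list \<Rightarrow> 'a list" where
  "block m i xs = take m (drop (i * m) xs)"

text \<open>Most significant bit first.\<close>

definition nat_of_bits :: "bool list \<Rightarrow> nat" where
  "nat_of_bits bs = horner_sum of_bool 2 (rev bs)"

definition bool_simon_length :: "nat \<Rightarrow> nat" where
  "bool_simon_length k = 2 ^ k * k"

text \<open>Decoding blocks of \<open>k\<close> bits is a bijection onto \<open>{0..<2 ^ k}\<close>, so the domain consists
  exactly of the encodings of the legal inputs of \<^const>\<open>lsb_simon\<close>.\<close>

definition bool_simon :: "nat \<Rightarrow> bool list \<rightharpoonup> bool" where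
  "bool_simon k bs =
     (if length bs = bool_simon_length k
      then map_option (\<lambda>v. v = 1) (lsb_simon k (map (\<lambda>i. nat_of_bits (block k i bs)) [0..<2 ^ k]))
      else None)"

definition xor_fun :: "nat \<Rightarrow> bool list \<rightharpoonup> bool" where
  "xor_fun m bs = (if length bs = m then Some (foldr (\<noteq>) bs False) else None)"

definition block_compose ::
    "nat \<Rightarrow> nat \<Rightarrow> (bool list \<rightharpoonup> bool) \<Rightarrow> (bool list \<rightharpoonup> bool) \<Rightarrow> (bool list \<rightharpoonup> bool)" where
  "block_compose n m f g bs =
     (if length bs = n * m \<and> (\<forall>i<n. g (block m i bs) \<noteq> None)
      then f (map (\<lambda>i. the (g (block m i bs))) [0..<n])
      else None)"


section \<open>Quantum decision trees\<close>

text \<open>The basis state \<open>|i\<rangle>|b\<rangle>|w\<rangle>\<close>, with \<open>i < N\<close>, one target bit \<open>b\<close> and \<open>w < W\<close>, is the unit vector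
  with index \<open>basis_index W i b w\<close> in dimension \<open>N * 2 * W\<close>. In particular \<open>|0\<rangle>|0\<rangle>|0\<rangle>\<close> has
  index \<open>0\<close>. The workspace dimension \<open>W\<close> is an arbitrary positive number.\<close>

definition basis_index :: "nat \<Rightarrow> nat \<Rightarrow> bool \<Rightarrow> nat \<Rightarrow> nat" where
  "basis_index W i b w = (i * 2 + of_bool b) * W + w"

definition oracle_mat :: "nat \<Rightarrow> nat \<Rightarrow> bool list \<Rightarrow> complex mat" where
  "oracle_mat N W x = mat (N * 2 * W) (N * 2 * W)
     (\<lambda>(r, c). of_bool (\<exists>i<N. \<exists>b. \<exists>w<W.
        c = basis_index W i b w \<and> r = basis_index W i (b \<noteq> x ! i) w))"

definition unitary_mat :: "nat \<Rightarrow> complex mat \<Rightarrow> bool" where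
  "unitary_mat d U \<longleftrightarrow>
     U \<in> carrier_mat d d \<and> mat_adjoint U * U = 1\<^sub>m d \<and> U * mat_adjoint U = 1\<^sub>m d"

text \<open>\<open>QDT W U0 [U1, \<dots>, Ut]\<close> makes \<open>t\<close> queries.\<close>

datatype qdt = QDT (qdt_workspace: nat) (qdt_init: "complex mat") (qdt_steps: "complex mat list")

definition qdt_dim :: "nat \<Rightarrow> qdt \<Rightarrow> nat" where
  "qdt_dim N A = N * 2 * qdt_workspace A"

definition qdt_queries :: "qdt \<Rightarrow> nat" where
  "qdt_queries A = length (qdt_steps A)"

definition qdt_wf :: "nat \<Rightarrow> qdt \<Rightarrow> bool" where
  "qdt_wf N A \<longleftrightarrow> qdt_workspace A > 0 \<and> unitary_mat (qdt_dim N A) (qdt_init A) \<and>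
     (\<forall>U\<in>set (qdt_steps A). unitary_mat (qdt_dim N A) U)"

definition qdt_final_state :: "nat \<Rightarrow> bool list \<Rightarrow> qdt \<Rightarrow> complex vec" where
  "qdt_final_state N x A =
     foldl (\<lambda>\<psi> U. U *\<^sub>v (oracle_mat N (qdt_workspace A) x *\<^sub>v \<psi>))
       (qdt_init A *\<^sub>v unit_vec (qdt_dim N A) 0) (qdt_steps A)"

definition qdt_prob :: "nat \<Rightarrow> bool list \<Rightarrow> qdt \<Rightarrow> nat \<Rightarrow> real" where
  "qdt_prob N x A j = (cmod (qdt_final_state N x A $ j))\<^sup>2"


section \<open>Hybrid decision trees\<close>

text \<open>The \<open>j\<close>-th child of an internal node corresponds to the measurement outcome \<open>j\<close>.\<close>

datatype 'b hybrid_tree = Leaf 'b | Node qdt "'b hybrid_tree list"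

primrec hybrid_wf :: "nat \<Rightarrow> 'b hybrid_tree \<Rightarrow> bool" where
  "hybrid_wf N (Leaf y) \<longleftrightarrow> True"
| "hybrid_wf N (Node A ts) \<longleftrightarrow>
     qdt_wf N A \<and> length ts = qdt_dim N A \<and> list_all (\<lambda>P. P) (map (hybrid_wf N) ts)"

primrec hybrid_limited :: "nat \<Rightarrow> 'b hybrid_tree \<Rightarrow> bool" where
  "hybrid_limited q (Leaf y) \<longleftrightarrow> True"
| "hybrid_limited q (Node A ts) \<longleftrightarrow>
     qdt_queries A \<le> q \<and> list_all (\<lambda>P. P) (map (hybrid_limited q) ts)"

primrec hybrid_path_costs :: "'b hybrid_tree \<Rightarrow> nat set" where
  "hybrid_path_costs (Leaf y) = {0}"
| "hybrid_path_costs (Node A ts) =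
     (\<lambda>c. qdt_queries A + c) ` (\<Union> (set (map hybrid_path_costs ts)))"

definition hybrid_cost :: "'b hybrid_tree \<Rightarrow> nat" where
  "hybrid_cost T = Max (hybrid_path_costs T)"

primrec hybrid_output_prob :: "nat \<Rightarrow> bool list \<Rightarrow> 'b \<Rightarrow> 'b hybrid_tree \<Rightarrow> real" where
  "hybrid_output_prob N x y (Leaf z) = of_bool (z = y)"
| "hybrid_output_prob N x y (Node A ts) =
     (\<Sum>j<length ts. qdt_prob N x A j * map (hybrid_output_prob N x y) ts ! j)"

definition hybrid_computes :: "nat \<Rightarrow> 'b hybrid_tree \<Rightarrow> (bool list \<rightharpoonup> 'b) \<Rightarrow> bool" where
  "hybrid_computes N T f \<longleftrightarrow> (\<forall>x y. f x = Some y \<longrightarrow> hybrid_output_prob N x y T \<ge> 2 / 3)"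

text \<open>\<open>hybrid_complexity q N f\<close> is \<open>H\<^sub>q(f)\<close> for a partial function \<open>f\<close> on strings of length \<open>N\<close>.
  For \<open>q \<ge> 1\<close> the minimum exists, see \<open>hybrid_complexity_attained\<close> below.\<close>

definition hybrid_complexity :: "nat \<Rightarrow> nat \<Rightarrow> (bool list \<rightharpoonup> bool) \<Rightarrow> nat" where
  "hybrid_complexity q N f =
     (LEAST c. \<exists>T. hybrid_wf N T \<and> hybrid_limited q T \<and> hybrid_computes N T f \<and> hybrid_cost T = c)"


section \<open>Asymptotics\<close>

text \<open>\<open>\<Omega>(g / polylog g)\<close>, where the exponent of the logarithm may be any constant.\<close>

definition soft_bigomega :: "(nat \<Rightarrow> real) \<Rightarrow> (nat \<Rightarrow> real) set" where
  "soft_bigomega g = {f. \<exists>d::nat. f \<in> \<Omega>(\<lambda>k. g k / log 2 (g k) ^ d)}"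

section \<open>The minimum defining \<^const>\<open>hybrid_complexity\<close> is attained\<close>

definition perm_mat :: "nat \<Rightarrow> (nat \<Rightarrow> nat) \<Rightarrow> complex mat" where
  "perm_mat d p = mat d d (\<lambda>(r, c). of_bool (r = p c))"

lemma perm_mat_unit_vec:
  assumes "c < d"
  shows "perm_mat d p *\<^sub>v unit_vec d c = unit_vec d (p c)"
  using assms by (intro eq_vecI) (auto simp: perm_mat_def scalar_prod_def unit_vec_def if_distrib cong: if_cong)

lemma unitary_one: "unitary_mat d (1\<^sub>m d)"
proof -
  have "mat_adjoint (1\<^sub>m d :: complex mat) = 1\<^sub>m d"
    by (intro eq_matI) (auto simp: mat_adjoint_def mat_of_rows_def)
  then show ?thesis by (simp add: unitary_mat_def)
qed

lemma unitary_perm_mat: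
  assumes p: "\<And>c. c < d \<Longrightarrow> p c < d" "\<And>c. c < d \<Longrightarrow> p (p c) = c"
  shows "unitary_mat d (perm_mat d p)"
proof -
  have sym: "mat_adjoint (perm_mat d p) = perm_mat d p"
    using p by (intro eq_matI) (auto simp: mat_adjoint_def mat_of_rows_def perm_mat_def)
  have "perm_mat d p * perm_mat d p = 1\<^sub>m d"
  proof (intro eq_matI)
    fix i j assume "i < dim_row (1\<^sub>m d :: complex mat)" "j < dim_col (1\<^sub>m d :: complex mat)"
    then have ij: "i < d" "j < d" by auto
    have "(perm_mat d p * perm_mat d p) $$ (i, j)
        = (\<Sum>k = 0..<d. of_bool (i = p k) * of_bool (k = p j))"
      using ij by (simp add: perm_mat_def scalar_prod_def)
    also have "\<dots> = (\<Sum>k = 0..<d. if k = p j then of_bool (i = p k) else 0)"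
      by (intro sum.cong) auto
    also have "\<dots> = of_bool (i = j)" using p ij by auto
    finally show "(perm_mat d p * perm_mat d p) $$ (i, j) = 1\<^sub>m d $$ (i, j)" using ij by simp
  qed (auto simp: perm_mat_def)
  then show ?thesis unfolding unitary_mat_def sym by (auto simp: perm_mat_def)
qed

lemma basis_index_less:
  assumes "i < N" "w < W"
  shows "basis_index W i b w < N * 2 * W"
proof -
  have "(i * 2 + of_bool b) * W + w < (i * 2 + of_bool b + 1) * W" using assms by simp
  also have "\<dots> \<le> (N * 2) * W" using assms by (intro mult_right_mono) auto
  finally show ?thesis by (simp add: basis_index_def)
qed

lemma basis_index_inj:
  assumes "basis_index W i b w = basis_index W i' b' w'" "w < W" "w' < W"
  shows "i = i' \<and> b = b' \<and> w = w'"
proof -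
  have "w = w'" using arg_cong[OF assms(1), of "\<lambda>s. s mod W"] assms(2,3) by (simp add: basis_index_def)
  moreover have "i * 2 + of_bool b = i' * 2 + (of_bool b' :: nat)"
    using assms \<open>w = w'\<close> by (simp add: basis_index_def)
  then have "(i * 2 + of_bool b) div 2 = (i' * 2 + (of_bool b' :: nat)) div 2"
    and "(i * 2 + of_bool b) mod 2 = (i' * 2 + (of_bool b' :: nat)) mod 2" by auto
  ultimately show ?thesis by (auto split: if_splits simp: of_bool_def)
qed

lemma oracle_mat_unit_vec:
  assumes "i < N" "w < W"
  shows "oracle_mat N W x *\<^sub>v unit_vec (N * 2 * W) (basis_index W i b w)
       = unit_vec (N * 2 * W) (basis_index W i (b \<noteq> x ! i) w)"
proof (intro eq_vecI)
  fix r assume "r < dim_vec (unit_vec (N * 2 * W) (basis_index W i (b \<noteq> x ! i) w) :: complex vec)"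
  then have r: "r < N * 2 * W" by simp
  have "(\<exists>i'<N. \<exists>b'. \<exists>w'<W. basis_index W i b w = basis_index W i' b' w' \<and>
            r = basis_index W i' (b' \<noteq> x ! i') w') \<longleftrightarrow> r = basis_index W i (b \<noteq> x ! i) w"
    (is "?L \<longleftrightarrow> ?R")
  proof
    assume ?L
    then obtain i' b' w' where *: "w' < W" "basis_index W i b w = basis_index W i' b' w'"
      "r = basis_index W i' (b' \<noteq> x ! i') w'" by blast
    then show ?R using basis_index_inj[OF *(2) assms(2) *(1)] by simp
  next
    assume ?R
    then show ?L using assms by blast
  qed
  then show "(oracle_mat N W x *\<^sub>v unit_vec (N * 2 * W) (basis_index W i b w)) $ r
      = unit_vec (N * 2 * W) (basis_index W i (b \<noteq> x ! i) w) $ r"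
    using r basis_index_less[OF assms, of b] basis_index_less[OF assms, of "b \<noteq> x ! i"]
    by (simp add: oracle_mat_def)
qed (simp add: oracle_mat_def)

definition query_bit :: "nat \<Rightarrow> nat \<Rightarrow> qdt" where
  "query_bit N i = QDT 1 (perm_mat (N * 2) (\<lambda>c. if c = 0 then 2 * i else if c = 2 * i then 0 else c))
     [1\<^sub>m (N * 2)]"

lemma query_bit_wf: "i < N \<Longrightarrow> qdt_wf N (query_bit N i)"
  unfolding qdt_wf_def query_bit_def qdt_dim_def by (auto intro!: unitary_perm_mat unitary_one)

lemma query_bit_prob:
  assumes "i < N" "j < N * 2"
  shows "qdt_prob N x (query_bit N i) j = of_bool (j = 2 * i + of_bool (x ! i))"
proof -
  have "qdt_final_state N x (query_bit N i)
      = 1\<^sub>m (N * 2) *\<^sub>v (oracle_mat N 1 x *\<^sub>v unit_vec (N * 2 * 1) (basis_index 1 i False 0))"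
    using assms by (simp add: qdt_final_state_def query_bit_def qdt_dim_def perm_mat_unit_vec
        basis_index_def mult.commute)
  also have "\<dots> = unit_vec (N * 2) (2 * i + of_bool (x ! i))"
    using oracle_mat_unit_vec[of i N 0 1 x False] assms by (simp add: basis_index_def mult.commute)
  finally show ?thesis using assms by (simp add: qdt_prob_def)
qed

primrec query_all :: "nat \<Rightarrow> (bool list \<Rightarrow> 'b) \<Rightarrow> nat \<Rightarrow> bool list \<Rightarrow> 'b hybrid_tree" where
  "query_all N h 0 bs = Leaf (h bs)"
| "query_all N h (Suc r) bs =
     Node (query_bit N (length bs)) (map (\<lambda>j. query_all N h r (bs @ [odd j])) [0..<N * 2])"

lemma query_all_wf:
  "length bs + r = N \<Longrightarrow> hybrid_wf N (query_all N h r bs) \<and> hybrid_limited 1 (query_all N h r bs)"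
proof (induction r arbitrary: bs)
  case (Suc r)
  then show ?case
    using query_bit_wf[of "length bs" N]
    by (auto simp: list_all_iff qdt_dim_def query_bit_def qdt_queries_def)
qed auto

lemma query_all_output:
  assumes "length x = N"
  shows "r \<le> N \<Longrightarrow> hybrid_output_prob N x (h x) (query_all N h r (take (N - r) x)) = 1"
proof (induction r)
  case 0
  then show ?case using assms by simp
next
  case (Suc r)
  let ?i = "N - Suc r" and ?t = "\<lambda>j. query_all N h r (take (N - Suc r) x @ [odd j])"
  let ?j = "2 * ?i + of_bool (x ! ?i)"
  have len: "length (take ?i x) = ?i" and i: "?i < N" using Suc.prems assms by auto
  have j: "?j < N * 2" using i by (cases "x ! ?i") auto
  have "hybrid_output_prob N x (h x) (query_all N h (Suc r) (take ?i x))
      = (\<Sum>j<N * 2. qdt_prob N x (query_bit N ?i) j * hybrid_output_prob N x (h x) (?t j))"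
    unfolding query_all.simps hybrid_output_prob.simps len by (intro sum.cong) auto
  also have "\<dots> = (\<Sum>j<N * 2. if j = ?j then hybrid_output_prob N x (h x) (?t j) else 0)"
    using i by (intro sum.cong) (auto simp: query_bit_prob)
  also have "\<dots> = hybrid_output_prob N x (h x) (?t ?j)" using j by simp
  also have "take ?i x @ [odd ?j] = take (N - r) x"
    using i assms Suc.prems by (simp add: Suc_diff_Suc flip: take_Suc_conv_app_nth)
  finally show ?case using Suc by simp
qed

lemma hybrid_complexity_attained:
  assumes "\<And>x. x \<in> dom f \<Longrightarrow> length x = N" "q \<ge> 1"
  obtains T where "hybrid_wf N T" "hybrid_limited q T" "hybrid_computes N T f"
    "hybrid_cost T = hybrid_complexity q N f"
proof -
  let ?T = "query_all N (\<lambda>x. the (f x)) N []"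
  have mono: "hybrid_limited 1 T \<Longrightarrow> hybrid_limited q T" for T :: "bool hybrid_tree"
    using assms(2) by (induction T) (auto simp: list_all_iff)
  have "hybrid_computes N ?T f"
    unfolding hybrid_computes_def
  proof (intro allI impI)
    fix x y assume "f x = Some y"
    then show "2 / 3 \<le> hybrid_output_prob N x y ?T"
      using query_all_output[of x N N "\<lambda>x. the (f x)"] assms(1)[of x] by (simp add: domI)
  qed
  moreover have "hybrid_wf N ?T" "hybrid_limited q ?T"
    using query_all_wf[of "[]" N N "\<lambda>x. the (f x)"] mono by simp_all
  ultimately have "\<exists>c T. hybrid_wf N T \<and> hybrid_limited q T \<and> hybrid_computes N T f \<and> hybrid_cost T = c"
    by blast
  from LeastI_ex[OF this] show thesis using that unfolding hybrid_complexity_def by blast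
qed

end

theory Submission
  imports Defs "HOL-Combinatorics.Permutations"
begin

text \<open>Fix a leaf of a one-query hybrid tree and the input outside a block \<open>S\<close> of \<open>m\<close> positions. The
  amplitude of the leaf is then a function on the subsets of \<open>S\<close>, and a measured query moves its Fourier
  weight by one level with probability at most the query weight on \<open>S\<close>. Hence on the leaves whose total
  query weight on \<open>S\<close> is at most \<open>1\<close> the energy weighted by \<open>4 ^ level\<close> stays bounded by a constant, and
  the correlation of the leaf probabilities with the parity of \<open>S\<close> is \<open>O(2 ^ - m)\<close>: changing the XOR of a
  light block is invisible, in total variation, up to that error.

  Now take \<open>\<pi>\<close> a random permutation, which is a legal input of Simon's problem with \<open>a = 0\<close>, and a random
  odd \<open>a\<close>. A leaf of a tree of cost \<open>t\<close> has at most \<open>t\<close> heavy indices, so it has two heavy indices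
  \<open>i\<close>, \<open>i \<oplus> a\<close> for at most \<open>t\<^sup>2\<close> of the \<open>K / 2\<close> values of \<open>a\<close>. On the other leaves the pairs can be merged
  one at a time, always overwriting a light partner, which turns \<open>\<pi>\<close> into a legal input with period \<open>a\<close>.
  As the two inputs have different values, \<open>t\<^sup>2\<close> is of order \<open>K\<close>.\<close>

section \<open>Fourier transform on the subsets of a finite set\<close>

text \<open>The characters of the group of subsets under symmetric difference. They are
  complex-valued because the functions expanded in them are amplitudes.\<close>

definition walsh :: "nat set \<Rightarrow> nat set \<Rightarrow> complex" where
  "walsh B X = (-1) ^ card (B \<inter> X)"

text \<open>Symmetric difference with \<open>{i}\<close>. It serves twice: it shifts Fourier
  indices, and later it changes one entry of a pattern of block parities.\<close>

definition flip :: "nat \<Rightarrow> nat set \<Rightarrow> nat set" where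
  "flip i B = (if i \<in> B then B - {i} else insert i B)"

definition fourier :: "nat set \<Rightarrow> (nat set \<Rightarrow> complex) \<Rightarrow> nat set \<Rightarrow> complex" where
  "fourier S g B = (\<Sum>X\<in>Pow S. g X * walsh B X)"

text \<open>The factor 4 per level is 2 per level on each amplitude: an index and its complement in
  \<open>S\<close> then contribute exactly 2 ^ \<open>card S\<close> together, and a shift by one
  level costs a factor of at most 4.\<close>

definition potential :: "nat set \<Rightarrow> (nat set \<Rightarrow> complex) \<Rightarrow> real" where
  "potential S g = (\<Sum>B\<in>Pow S. 4 ^ card B * (cmod (fourier S g B))\<^sup>2)"

lemma flip_flip [simp]: "flip i (flip i B) = B"
  by (auto simp: flip_def)

lemma flip_Pow: "i \<in> S \<Longrightarrow> B \<in> Pow S \<Longrightarrow> flip i B \<in> Pow S"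
  by (auto simp: flip_def)

lemma sum_Pow_flip:
  assumes "i \<in> S"
  shows "(\<Sum>B\<in>Pow S. f (flip i B)) = (\<Sum>B\<in>Pow S. f B)"
  by (rule sum.reindex_bij_witness[of _ "flip i" "flip i"]) (use assms flip_Pow in auto)

lemma walsh_commute: "walsh B X = walsh X B"
  by (simp add: walsh_def Int_commute)

lemma walsh_empty [simp]: "walsh {} X = 1" "walsh B {} = 1"
  by (simp_all add: walsh_def)

lemma cnj_walsh [simp]: "cnj (walsh B X) = walsh B X"
  by (simp add: walsh_def)

lemma walsh_flip:
  assumes "finite B"
  shows "walsh (flip i B) X = (if i \<in> X then - walsh B X else walsh B X)"
proof (cases "i \<in> X")
  case False
  then have "flip i B \<inter> X = B \<inter> X" by (auto simp: flip_def)
  then show ?thesis using False by (simp add: walsh_def)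
next
  case True
  show ?thesis
  proof (cases "i \<in> B")
    case i: True
    then have "B \<inter> X = insert i (flip i B \<inter> X)" "i \<notin> flip i B \<inter> X" "finite (flip i B \<inter> X)"
      using True assms by (auto simp: flip_def)
    then have "card (B \<inter> X) = Suc (card (flip i B \<inter> X))" by (metis card_insert_disjoint)
    then show ?thesis using True by (simp add: walsh_def)
  next
    case i: False
    then have "flip i B \<inter> X = insert i (B \<inter> X)" "i \<notin> B \<inter> X" "finite (B \<inter> X)"
      using True assms by (auto simp: flip_def)
    then have "card (flip i B \<inter> X) = Suc (card (B \<inter> X))" by (metis card_insert_disjoint)
    then show ?thesis using True by (simp add: walsh_def)
  qed
qed

lemma walsh_union:
  assumes "finite B" "finite C" "B \<inter> C = {}"
  shows "walsh (B \<union> C) X = walsh B X * walsh C X"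
proof -
  have "card ((B \<union> C) \<inter> X) = card (B \<inter> X) + card (C \<inter> X)"
    using assms by (subst card_Un_disjoint[symmetric]) (auto simp: Int_Un_distrib2)
  then show ?thesis by (simp add: walsh_def power_add)
qed

text \<open>Flipping an element of \<open>X\<close> in \<open>B\<close> reverses the sign of every
  term, so the sum equals its own negative.\<close>

lemma sum_walsh_eq_0:
  assumes "finite S" "X \<subseteq> S" "X \<noteq> {}"
  shows "(\<Sum>B\<in>Pow S. walsh B X) = 0"
proof -
  obtain i where i: "i \<in> X" using assms by auto
  have "(\<Sum>B\<in>Pow S. walsh B X) = (\<Sum>B\<in>Pow S. walsh (flip i B) X)"
    using i assms by (intro sum_Pow_flip[symmetric]) auto
  also have "\<dots> = (\<Sum>B\<in>Pow S. - walsh B X)"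
    using i assms by (intro sum.cong refl) (auto simp: walsh_flip finite_subset)
  finally show ?thesis by (simp add: sum_negf)
qed

text \<open>Each element of \<open>X \<inter> Y\<close> can change the sign of both factors, so it
  cancels.\<close>

lemma walsh_mult_eq:
  assumes "finite X" "finite Y"
  shows "walsh B X * walsh B Y = walsh B ((X - Y) \<union> (Y - X))"
proof -
  have split: "walsh X B = walsh (X - Y) B * walsh (X \<inter> Y) B" if "finite X" for X Y
  proof -
    have "walsh ((X - Y) \<union> (X \<inter> Y)) B = walsh (X - Y) B * walsh (X \<inter> Y) B"
      using that by (intro walsh_union) auto
    then show ?thesis by (simp only: Un_Diff_Int)
  qed
  have "walsh X B = walsh (X - Y) B * walsh (X \<inter> Y) B" "walsh Y B = walsh (Y - X) B * walsh (X \<inter> Y) B"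
    using split[OF assms(1), of Y] split[OF assms(2), of X] by (simp_all only: Int_commute)
  then have "walsh X B * walsh Y B = walsh (X - Y) B * walsh (Y - X) B * (walsh (X \<inter> Y) B * walsh (X \<inter> Y) B)"
    by simp
  moreover have "walsh (X - Y \<union> (Y - X)) B = walsh (X - Y) B * walsh (Y - X) B"
    using assms by (intro walsh_union) auto
  moreover have "walsh (X \<inter> Y) B * walsh (X \<inter> Y) B = 1"
    by (simp add: walsh_def flip: power_mult_distrib)
  ultimately show ?thesis by (simp only: walsh_commute[of B] mult_1_right)
qed

lemma sum_walsh_mult:
  assumes "finite S" "X \<subseteq> S" "Y \<subseteq> S"
  shows "(\<Sum>B\<in>Pow S. walsh B X * walsh B Y) = (if X = Y then 2 ^ card S else 0)"
proof -
  have "finite X" "finite Y" using assms finite_subset by auto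
  then have *: "(\<Sum>B\<in>Pow S. walsh B X * walsh B Y) = (\<Sum>B\<in>Pow S. walsh B ((X - Y) \<union> (Y - X)))"
    by (simp add: walsh_mult_eq)
  show ?thesis
  proof (cases "X = Y")
    case True
    then show ?thesis unfolding * using assms by (simp add: card_Pow)
  next
    case False
    then show ?thesis unfolding * using assms by (subst sum_walsh_eq_0) auto
  qed
qed

lemma parseval:
  assumes "finite S"
  shows "(\<Sum>B\<in>Pow S. fourier S g B * cnj (fourier S h B)) = 2 ^ card S * (\<Sum>X\<in>Pow S. g X * cnj (h X))"
proof -
  have "(\<Sum>B\<in>Pow S. fourier S g B * cnj (fourier S h B))
      = (\<Sum>B\<in>Pow S. \<Sum>X\<in>Pow S. \<Sum>Y\<in>Pow S. g X * cnj (h Y) * (walsh B X * walsh B Y))"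
    by (simp add: fourier_def cnj_sum sum_product mult_ac)
  also have "\<dots> = (\<Sum>X\<in>Pow S. \<Sum>B\<in>Pow S. \<Sum>Y\<in>Pow S. g X * cnj (h Y) * (walsh B X * walsh B Y))"
    by (rule sum.swap)
  also have "\<dots> = (\<Sum>X\<in>Pow S. \<Sum>Y\<in>Pow S. \<Sum>B\<in>Pow S. g X * cnj (h Y) * (walsh B X * walsh B Y))"
    by (intro sum.cong refl sum.swap)
  also have "\<dots> = (\<Sum>X\<in>Pow S. \<Sum>Y\<in>Pow S. g X * cnj (h Y) * (\<Sum>B\<in>Pow S. walsh B X * walsh B Y))"
    by (simp add: sum_distrib_left)
  also have "\<dots> = (\<Sum>X\<in>Pow S. \<Sum>Y\<in>Pow S. if X = Y then g X * cnj (h Y) * 2 ^ card S else 0)"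
    using assms by (intro sum.cong refl) (auto simp: sum_walsh_mult)
  also have "\<dots> = (\<Sum>X\<in>Pow S. g X * cnj (h X) * 2 ^ card S)"
    using assms by (simp add: sum.delta')
  finally show ?thesis by (simp add: sum_distrib_left mult_ac)
qed

text \<open>The character of \<open>S\<close> is the product of those of \<open>B\<close> and
  \<open>S - B\<close>, and the one of \<open>B\<close> squares to 1. This is why the parity of
  \<open>S\<close> pairs each level with the complementary one.\<close>

lemma fourier_mult_walsh:
  assumes "finite S" "B \<subseteq> S"
  shows "fourier S (\<lambda>X. g X * walsh S X) B = fourier S g (S - B)"
  unfolding fourier_def
proof (intro sum.cong refl)
  fix X
  have "finite B" using assms finite_subset by auto
  have "S = B \<union> (S - B)" using assms by auto
  then have "walsh S X = walsh B X * walsh (S - B) X"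
    using walsh_union[of B "S - B" X] assms \<open>finite B\<close> by (metis Diff_disjoint finite_Diff)
  moreover have "walsh B X * walsh B X = 1" by (simp add: walsh_def flip: power_mult_distrib)
  ultimately show "g X * walsh S X * walsh B X = g X * walsh (S - B) X"
    by (metis mult.assoc mult.commute mult_1)
qed

text \<open>In the Fourier expansion of the bias, the levels of the two factors add up to \<open>card S\<close>,
  so AM-GM turns it into the exponentially weighted energy \<^const>\<open>potential\<close>.\<close>

lemma bias_le_potential:
  assumes "finite S"
  shows "4 ^ card S * cmod (\<Sum>X\<in>Pow S. (cmod (g X))\<^sup>2 * walsh S X) \<le> potential S g"
proof -
  let ?m = "card S" and ?F = "\<lambda>B. cmod (fourier S g B)"
  have four: "(4::real) ^ ?m = 2 ^ ?m * 2 ^ ?m" by (simp flip: power_mult_distrib)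
  have bij: "(\<Sum>B\<in>Pow S. f (S - B)) = (\<Sum>B\<in>Pow S. f B)" for f :: "nat set \<Rightarrow> real"
    by (rule sum.reindex_bij_witness[of _ "\<lambda>B. S - B" "\<lambda>B. S - B"]) auto
  \<comment> \<open>Parseval for \<open>g\<close> and for \<open>g\<close> times the parity
    character.\<close>
  have "2 ^ ?m * (\<Sum>X\<in>Pow S. (cmod (g X))\<^sup>2 * walsh S X)
      = (\<Sum>B\<in>Pow S. fourier S g B * cnj (fourier S (\<lambda>X. g X * walsh S X) B))"
    using assms by (subst parseval) (simp_all add: complex_norm_square[symmetric] mult.assoc[symmetric] del: of_real_power)
  also have "\<dots> = (\<Sum>B\<in>Pow S. fourier S g B * cnj (fourier S g (S - B)))"
    using assms by (intro sum.cong refl) (simp add: fourier_mult_walsh)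
  finally have "2 ^ ?m * cmod (\<Sum>X\<in>Pow S. (cmod (g X))\<^sup>2 * walsh S X)
      = cmod (\<Sum>B\<in>Pow S. fourier S g B * cnj (fourier S g (S - B)))"
    by (drule_tac arg_cong[of _ _ cmod]) (simp add: norm_mult norm_power)
  also have "\<dots> \<le> (\<Sum>B\<in>Pow S. ?F B * ?F (S - B))"
    by (rule order_trans[OF norm_sum]) (simp add: norm_mult)
  finally have "2 ^ ?m * (2 ^ ?m * cmod (\<Sum>X\<in>Pow S. (cmod (g X))\<^sup>2 * walsh S X))
      \<le> 2 ^ ?m * (\<Sum>B\<in>Pow S. ?F B * ?F (S - B))" by simp
  also have "\<dots> = (\<Sum>B\<in>Pow S. (2 ^ card B * ?F B) * (2 ^ card (S - B) * ?F (S - B)))"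
    unfolding sum_distrib_left
  proof (intro sum.cong refl)
    fix B assume "B \<in> Pow S"
    then have "card S = card B + card (S - B)"
      using assms by (metis PowD card_Diff_subset card_mono finite_subset le_add_diff_inverse)
    then show "2 ^ card S * (?F B * ?F (S - B)) = 2 ^ card B * ?F B * (2 ^ card (S - B) * ?F (S - B))"
      by (simp add: power_add)
  qed
  also have "\<dots> \<le> (\<Sum>B\<in>Pow S. ((2 ^ card B * ?F B)\<^sup>2 + (2 ^ card (S - B) * ?F (S - B))\<^sup>2) / 2)"
  proof (intro sum_mono)
    fix B
    show "2 ^ card B * ?F B * (2 ^ card (S - B) * ?F (S - B))
        \<le> ((2 ^ card B * ?F B)\<^sup>2 + (2 ^ card (S - B) * ?F (S - B))\<^sup>2) / 2"
      using sum_squares_bound[of "2 ^ card B * ?F B" "2 ^ card (S - B) * ?F (S - B)"] by simp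
  qed
  also have "\<dots> = ((\<Sum>B\<in>Pow S. (2 ^ card B * ?F B)\<^sup>2) + (\<Sum>B\<in>Pow S. (2 ^ card (S - B) * ?F (S - B))\<^sup>2)) / 2"
    by (simp add: sum.distrib flip: sum_divide_distrib)
  also have "\<dots> = (\<Sum>B\<in>Pow S. (2 ^ card B * ?F B)\<^sup>2)"
    using bij[of "\<lambda>B. (2 ^ card B * ?F B)\<^sup>2"] by simp
  also have "\<dots> = potential S g"
    unfolding potential_def
    by (intro sum.cong refl) (simp add: power_mult_distrib power2_eq_square flip: power_mult_distrib)
  finally show ?thesis by (simp add: flip: power_mult_distrib mult.assoc)
qed

text \<open>The amplitude at the root is the constant 1, with all its Fourier weight on level 0. The
  resulting 4 ^ \<open>card S\<close> will cancel the factor in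
  \<open>bias_le_potential\<close>.\<close>

lemma potential_1:
  assumes "finite S"
  shows "potential S (\<lambda>_. 1) = 4 ^ card S"
proof -
  have "fourier S (\<lambda>_. 1) B = (if B = {} then 2 ^ card S else 0)" if "B \<in> Pow S" for B
    using that sum_walsh_eq_0[of S B] assms by (auto simp: fourier_def walsh_commute card_Pow)
  then have "potential S (\<lambda>_. 1) = (\<Sum>B\<in>Pow S. if B = {} then (2 ^ card S)\<^sup>2 else 0)"
    unfolding potential_def by (intro sum.cong refl) (auto simp: norm_power)
  also have "\<dots> = (2 ^ card S)\<^sup>2" using assms by (simp add: sum.delta)
  also have "\<dots> = 4 ^ card S" by (simp add: power_mult[symmetric] mult.commute[of _ 2] power_mult[of 2 2])
  finally show ?thesis .
qed

lemma potential_empty: "potential {} g = (cmod (g {}))\<^sup>2"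
  by (simp add: potential_def fourier_def)

lemma potential_nonneg: "potential S g \<ge> 0"
  unfolding potential_def by (intro sum_nonneg) auto

text \<open>After reindexing by the flip only the level weights change, and a flip raises the level
  by at most one.\<close>

lemma sum_flip_le_potential:
  assumes "finite S" "i \<in> S"
  shows "(\<Sum>B\<in>Pow S. 4 ^ card B * (cmod (fourier S g (flip i B)))\<^sup>2) \<le> 4 * potential S g"
proof -
  have "(\<Sum>B\<in>Pow S. 4 ^ card B * (cmod (fourier S g (flip i B)))\<^sup>2)
      = (\<Sum>B\<in>Pow S. 4 ^ card (flip i B) * (cmod (fourier S g B))\<^sup>2)"
    using sum_Pow_flip[OF assms(2), of "\<lambda>B. 4 ^ card (flip i B) * (cmod (fourier S g B))\<^sup>2"] by simp
  also have "\<dots> \<le> (\<Sum>B\<in>Pow S. 4 ^ Suc (card B) * (cmod (fourier S g B))\<^sup>2)"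
  proof (intro sum_mono mult_right_mono power_increasing)
    fix B assume "B \<in> Pow S"
    then have "finite B" using assms finite_subset by auto
    then show "card (flip i B) \<le> Suc (card B)"
      by (auto simp: flip_def card_insert_if intro: le_SucI card_mono)
  qed auto
  also have "\<dots> = 4 * potential S g" by (simp add: potential_def sum_distrib_left mult.assoc)
  finally show ?thesis .
qed


section \<open>One measured query\<close>

definition bits_of :: "nat \<Rightarrow> nat set \<Rightarrow> bool list" where
  "bits_of N X = map (\<lambda>i. i \<in> X) [0..<N]"

definition initial_state :: "nat \<Rightarrow> qdt \<Rightarrow> complex vec" where
  "initial_state N A = qdt_init A *\<^sub>v unit_vec (qdt_dim N A) 0"

text \<open>For a node with a single query this is the probability of finding \<open>i\<close> in
  the query register when the query is made. The state at that moment does not depend on the input,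
  so a leaf can carry its weights as fixed numbers.\<close>

definition query_weight :: "nat \<Rightarrow> qdt \<Rightarrow> nat \<Rightarrow> real" where
  "query_weight N A i = (if qdt_queries A = 0 then 0 else
     \<Sum>w<qdt_workspace A. \<Sum>b\<in>UNIV.
       (cmod (initial_state N A $ basis_index (qdt_workspace A) i b w))\<^sup>2)"

section \<open>Unitaries and the oracle in coordinates\<close>

lemma unitary_norm:
  assumes "unitary_mat d U"
  shows "(\<Sum>j<d. (cmod (\<Sum>r<d. U $$ (j, r) * v r))\<^sup>2) = (\<Sum>r<d. (cmod (v r))\<^sup>2)"
proof -
  have U: "U \<in> carrier_mat d d" "mat_adjoint U * U = 1\<^sub>m d" using assms by (auto simp: unitary_mat_def)
  have orth: "(\<Sum>j<d. U $$ (j, r) * cnj (U $$ (j, s))) = (if r = s then 1 else 0)"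
    if "r < d" "s < d" for r s
  proof -
    have "(mat_adjoint U * U) $$ (s, r) = (\<Sum>j<d. U $$ (j, r) * cnj (U $$ (j, s)))"
      using U(1) that by (auto simp: mat_adjoint_def mat_of_rows_def scalar_prod_def lessThan_atLeast0 mult.commute
          intro!: sum.cong)
    then show ?thesis using U(2) that by auto
  qed
  have "complex_of_real (\<Sum>j<d. (cmod (\<Sum>r<d. U $$ (j, r) * v r))\<^sup>2)
      = (\<Sum>j<d. \<Sum>r<d. \<Sum>s<d. v r * cnj (v s) * (U $$ (j, r) * cnj (U $$ (j, s))))"
    by (simp add: complex_norm_square cnj_sum sum_product mult_ac del: of_real_power)
  also have "\<dots> = (\<Sum>r<d. \<Sum>j<d. \<Sum>s<d. v r * cnj (v s) * (U $$ (j, r) * cnj (U $$ (j, s))))"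
    by (rule sum.swap)
  also have "\<dots> = (\<Sum>r<d. \<Sum>s<d. \<Sum>j<d. v r * cnj (v s) * (U $$ (j, r) * cnj (U $$ (j, s))))"
    by (intro sum.cong refl sum.swap)
  also have "\<dots> = (\<Sum>r<d. \<Sum>s<d. if r = s then v r * cnj (v s) else 0)"
    by (intro sum.cong refl) (auto simp: orth simp flip: sum_distrib_left)
  also have "\<dots> = (\<Sum>r<d. v r * cnj (v r))" by (intro sum.cong refl) (simp add: sum.delta')
  also have "\<dots> = complex_of_real (\<Sum>r<d. (cmod (v r))\<^sup>2)"
    by (simp add: complex_norm_square del: of_real_power)
  finally show ?thesis using of_real_eq_iff by blast
qed

text \<open>The target bit is innermost, which keeps together the two amplitudes that a query may
  exchange.\<close>

lemma sum_basis_index: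
  "(\<Sum>r<N * 2 * W. f r) = (\<Sum>i<N. \<Sum>w<W. \<Sum>b\<in>UNIV. f (basis_index W i b w))"
proof -
  let ?D = "{..<N} \<times> {..<W} \<times> (UNIV :: bool set)" and ?h = "\<lambda>(i, w, b). basis_index W i b w"
  have inj: "inj_on ?h ?D" by (auto simp: inj_on_def dest!: basis_index_inj)
  moreover have "?h ` ?D = {..<N * 2 * W}"
  proof (rule card_subset_eq)
    show "?h ` ?D \<subseteq> {..<N * 2 * W}" using basis_index_less by auto
    show "card (?h ` ?D) = card {..<N * 2 * W}"
      unfolding card_image[OF inj] by (simp add: card_cartesian_product)
  qed auto
  ultimately have "(\<Sum>r<N * 2 * W. f r) = (\<Sum>(i, w, b)\<in>?D. f (basis_index W i b w))"
    using sum.reindex[of ?h ?D f] by (simp add: case_prod_unfold comp_def)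
  then show ?thesis by (simp add: sum.cartesian_product)
qed

lemma oracle_mat_mult_vec:
  assumes "i < N" "w < W" "v \<in> carrier_vec (N * 2 * W)"
  shows "(oracle_mat N W x *\<^sub>v v) $ basis_index W i b w = v $ basis_index W i (b \<noteq> x ! i) w"
proof -
  let ?r = "basis_index W i b w" and ?c = "basis_index W i (b \<noteq> x ! i) w"
  have r: "?r < N * 2 * W" "?c < N * 2 * W" using assms basis_index_less by auto
  have "(\<exists>i'<N. \<exists>b'. \<exists>w'<W. c = basis_index W i' b' w' \<and> ?r = basis_index W i' (b' \<noteq> x ! i') w') \<longleftrightarrow> c = ?c"
    (is "?L \<longleftrightarrow> _") for c
  proof
    assume ?L
    then obtain i' b' w' where *: "w' < W" "c = basis_index W i' b' w'"
      "?r = basis_index W i' (b' \<noteq> x ! i') w'" by blast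
    then show "c = ?c" using basis_index_inj[OF *(3) assms(2) *(1)] by auto
  next
    assume "c = ?c"
    moreover have "?r = basis_index W i ((b \<noteq> x ! i) \<noteq> x ! i) w" by (cases "x ! i") auto
    ultimately show ?L using assms by blast
  qed
  then have "(oracle_mat N W x *\<^sub>v v) $ ?r = (\<Sum>c<N * 2 * W. of_bool (c = ?c) * v $ c)"
    using r assms(3) by (simp add: oracle_mat_def scalar_prod_def lessThan_atLeast0)
  also have "\<dots> = (\<Sum>c<N * 2 * W. if c = ?c then v $ c else 0)" by (intro sum.cong) auto
  finally show ?thesis using r by simp
qed

lemma initial_state_carrier:
  "qdt_wf N A \<Longrightarrow> initial_state N A \<in> carrier_vec (qdt_dim N A)"
  by (auto simp: initial_state_def qdt_wf_def unitary_mat_def)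

lemma initial_state_norm:
  assumes "qdt_wf N A" "N > 0"
  shows "(\<Sum>r<qdt_dim N A. (cmod (initial_state N A $ r))\<^sup>2) = 1"
proof -
  let ?d = "qdt_dim N A" and ?e = "\<lambda>r. of_bool (r = 0) :: complex"
  have d: "?d > 0" using assms by (simp add: qdt_dim_def qdt_wf_def)
  have U: "unitary_mat ?d (qdt_init A)" "qdt_init A \<in> carrier_mat ?d ?d"
    using assms by (auto simp: qdt_wf_def unitary_mat_def)
  have "initial_state N A $ j = (\<Sum>r<?d. qdt_init A $$ (j, r) * ?e r)" if "j < ?d" for j
    using that U d
    by (auto simp: initial_state_def scalar_prod_def unit_vec_def lessThan_atLeast0 of_bool_def if_distrib cong: if_cong)
  then have "(\<Sum>r<?d. (cmod (initial_state N A $ r))\<^sup>2) = (\<Sum>r<?d. (cmod (?e r))\<^sup>2)"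
    using unitary_norm[OF U(1), of ?e] by simp
  also have "\<dots> = (\<Sum>r<?d. if r = 0 then 1 else 0)" by (intro sum.cong) auto
  finally show ?thesis using d by simp
qed

lemma query_weight_nonneg: "query_weight N A i \<ge> 0"
  by (auto simp: query_weight_def intro!: sum_nonneg)

lemma sum_query_weight:
  assumes "qdt_wf N A" "N > 0"
  shows "(\<Sum>i<N. query_weight N A i) \<le> qdt_queries A"
proof (cases "qdt_queries A = 0")
  case False
  then have "(\<Sum>i<N. query_weight N A i) = (\<Sum>r<qdt_dim N A. (cmod (initial_state N A $ r))\<^sup>2)"
    by (simp add: query_weight_def qdt_dim_def sum_basis_index)
  then show ?thesis using False initial_state_norm[OF assms] by simp
qed (simp add: query_weight_def)

section \<open>Effect of one query on the potential\<close>

lemma fourier_cmult: "fourier S (\<lambda>Z. g Z * c) B = c * fourier S g B"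
  by (simp add: fourier_def sum_distrib_left mult_ac)

lemma potential_cmult: "potential S (\<lambda>Z. g Z * c) = (cmod c)\<^sup>2 * potential S g"
  unfolding potential_def fourier_cmult by (simp add: norm_mult power_mult_distrib sum_distrib_left mult_ac)

lemma parallelogram: "(cmod (u + v))\<^sup>2 + (cmod (u - v))\<^sup>2 = 2 * (cmod u)\<^sup>2 + 2 * (cmod v)\<^sup>2"
  unfolding cmod_power2 by (simp add: power2_eq_square algebra_simps)

text \<open>In the basis \<open>|+\<rangle>, |-\<rangle>\<close> of the target bit a query of position \<open>i\<close> acts on \<open>|-\<rangle>\<close> only, where
  it multiplies by the character of \<open>{i}\<close>, that is, shifts the Fourier index by \<open>flip i\<close>.\<close>

lemma fourier_query:
  assumes "finite S" "B \<subseteq> S"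
  shows "(\<Sum>b\<in>UNIV. (cmod (fourier S (\<lambda>Z. g Z * (if b \<noteq> (i \<in> Z) then q else p)) B))\<^sup>2)
    = (cmod (p + q))\<^sup>2 / 2 * (cmod (fourier S g B))\<^sup>2 + (cmod (p - q))\<^sup>2 / 2 * (cmod (fourier S g (flip i B)))\<^sup>2"
proof -
  let ?s = "(p + q) / 2" and ?t = "(p - q) / 2"
  let ?u = "?s * fourier S g B" and ?v = "?t * fourier S g (flip i B)"
  have "finite B" using assms finite_subset by auto
  have F: "fourier S (\<lambda>Z. g Z * (if b \<noteq> (i \<in> Z) then q else p)) B = ?u + (if b then - 1 else 1) * ?v" for b
  proof -
    have "g Z * (if b \<noteq> (i \<in> Z) then q else p) * walsh B Z
        = ?s * (g Z * walsh B Z) + (if b then - 1 else 1) * (?t * (g Z * walsh (flip i B) Z))" for Z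
      using walsh_flip[OF \<open>finite B\<close>, of i Z] by (cases b; cases "i \<in> Z") (auto simp: field_simps)
    then show ?thesis by (simp add: fourier_def sum.distrib sum_distrib_left)
  qed
  have "(\<Sum>b\<in>UNIV. (cmod (fourier S (\<lambda>Z. g Z * (if b \<noteq> (i \<in> Z) then q else p)) B))\<^sup>2)
      = (cmod (?u + ?v))\<^sup>2 + (cmod (?u - ?v))\<^sup>2"
    unfolding F by (simp add: UNIV_bool)
  also have "\<dots> = 2 * (cmod ?u)\<^sup>2 + 2 * (cmod ?v)\<^sup>2" by (rule parallelogram)
  finally show ?thesis by (simp add: norm_mult norm_divide power_mult_distrib power_divide)
qed

lemma potential_query_inside:
  assumes "finite S" "i \<in> S"
  shows "(\<Sum>b\<in>UNIV. potential S (\<lambda>Z. g Z * (if b \<noteq> (i \<in> Z) then q else p)))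
    \<le> 4 * ((cmod p)\<^sup>2 + (cmod q)\<^sup>2) * potential S g"
proof -
  let ?a = "(cmod (p + q))\<^sup>2 / 2" and ?b = "(cmod (p - q))\<^sup>2 / 2"
  have "(\<Sum>b\<in>UNIV. potential S (\<lambda>Z. g Z * (if b \<noteq> (i \<in> Z) then q else p)))
      = (\<Sum>B\<in>Pow S. 4 ^ card B * (\<Sum>b\<in>UNIV. (cmod (fourier S (\<lambda>Z. g Z * (if b \<noteq> (i \<in> Z) then q else p)) B))\<^sup>2))"
    unfolding potential_def by (subst sum.swap) (simp add: sum_distrib_left)
  also have "\<dots> = (\<Sum>B\<in>Pow S. 4 ^ card B * (?a * (cmod (fourier S g B))\<^sup>2 + ?b * (cmod (fourier S g (flip i B)))\<^sup>2))"
    using assms by (intro sum.cong refl) (subst fourier_query, auto)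
  also have "\<dots> = ?a * potential S g + ?b * (\<Sum>B\<in>Pow S. 4 ^ card B * (cmod (fourier S g (flip i B)))\<^sup>2)"
    by (simp add: potential_def sum.distrib sum_distrib_left algebra_simps)
  \<comment> \<open>Only the shifted part needs the factor 4. Giving it to both parts lets the
    parallelogram law turn \<open>?a + ?b\<close> into the total weight of the pair
    \<open>p\<close>, \<open>q\<close>.\<close>
  also have "\<dots> \<le> ?a * (4 * potential S g) + ?b * (4 * potential S g)"
    using sum_flip_le_potential[OF assms, of g] potential_nonneg[of S g]
    by (intro add_mono mult_left_mono) auto
  also have "\<dots> = 4 * ((cmod p)\<^sup>2 + (cmod q)\<^sup>2) * potential S g"
  proof -
    have "?a * (4 * potential S g) + ?b * (4 * potential S g) = 4 * (?a + ?b) * potential S g"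
      by (simp only: distrib_left distrib_right mult_ac)
    moreover have "?a + ?b = (cmod p)\<^sup>2 + (cmod q)\<^sup>2" using parallelogram[of p q] by simp
    ultimately show ?thesis by simp
  qed
  finally show ?thesis .
qed

text \<open>Outside \<open>S\<close> the answer \<open>c\<close> is fixed, so the query at most
  exchanges the two amplitudes and the level distribution stays put.\<close>

lemma potential_query_outside:
  "(\<Sum>b\<in>UNIV. potential S (\<lambda>Z. g Z * (if b \<noteq> (c :: bool) then q else p)))
    = ((cmod p)\<^sup>2 + (cmod q)\<^sup>2) * potential S g"
  by (cases c) (simp_all add: UNIV_bool potential_cmult algebra_simps)

text \<open>\<open>U\<close> acts on the basis states and the Fourier transform on the input, so
  they commute; norm preservation then holds for each Fourier index separately.\<close>

lemma potential_unitary: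
  assumes "unitary_mat d U"
  shows "(\<Sum>j<d. potential S (\<lambda>Z. g Z * (\<Sum>r<d. U $$ (j, r) * v Z r))) = (\<Sum>r<d. potential S (\<lambda>Z. g Z * v Z r))"
proof -
  have "fourier S (\<lambda>Z. g Z * (\<Sum>r<d. U $$ (j, r) * v Z r)) B
      = (\<Sum>r<d. U $$ (j, r) * fourier S (\<lambda>Z. g Z * v Z r) B)" for j B
    unfolding fourier_def sum_distrib_left sum_distrib_right
    by (subst sum.swap) (simp add: mult_ac)
  then have "(\<Sum>j<d. potential S (\<lambda>Z. g Z * (\<Sum>r<d. U $$ (j, r) * v Z r)))
      = (\<Sum>B\<in>Pow S. 4 ^ card B * (\<Sum>j<d. (cmod (\<Sum>r<d. U $$ (j, r) * fourier S (\<lambda>Z. g Z * v Z r) B))\<^sup>2))"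
    unfolding potential_def by (subst sum.swap) (simp add: sum_distrib_left)
  also have "\<dots> = (\<Sum>r<d. potential S (\<lambda>Z. g Z * v Z r))"
    unfolding potential_def unitary_norm[OF assms] by (subst sum.swap) (simp add: sum_distrib_left)
  finally show ?thesis .
qed

text \<open>\<open>X\<close> fixes the input outside \<open>S\<close>, \<open>Z\<close> varies on
  \<open>S\<close>, and \<open>g\<close> is the amplitude collected so far. Query weight on
  \<open>S\<close> costs a factor of 4 and the remaining weight a factor of 1, which adds up to 1
  plus 3 times the weight on \<open>S\<close>.\<close>

lemma potential_step:
  assumes A: "qdt_wf N A" "qdt_queries A \<le> 1" "N > 0" and S: "S \<subseteq> {..<N}" "X \<inter> S = {}"
  shows "(\<Sum>j<qdt_dim N A. potential S (\<lambda>Z. g Z * qdt_final_state N (bits_of N (X \<union> Z)) A $ j))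
    \<le> (1 + 3 * (\<Sum>i\<in>S. query_weight N A i)) * potential S g"
proof (cases "qdt_steps A")
  case Nil
  then have "qdt_final_state N x A = initial_state N A" for x
    by (simp add: qdt_final_state_def initial_state_def)
  moreover have "query_weight N A i = 0" for i using Nil by (simp add: query_weight_def qdt_queries_def)
  ultimately show ?thesis
    using initial_state_norm[OF A(1,3)] by (simp add: potential_cmult flip: sum_distrib_right)
next
  case (Cons U Us)
  then have steps: "qdt_steps A = [U]" and q: "qdt_queries A \<noteq> 0" using A(2) by (auto simp: qdt_queries_def)
  let ?W = "qdt_workspace A" and ?d = "qdt_dim N A" and ?\<psi> = "initial_state N A"
  let ?v = "\<lambda>Z. oracle_mat N ?W (bits_of N (X \<union> Z)) *\<^sub>v ?\<psi>"
  let ?n = "\<lambda>i w. \<Sum>b\<in>UNIV. (cmod (?\<psi> $ basis_index ?W i b w))\<^sup>2"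
  have "finite S" using S finite_subset by auto
  have U: "unitary_mat ?d U" "U \<in> carrier_mat ?d ?d" using A(1) steps by (auto simp: qdt_wf_def unitary_mat_def)
  have \<psi>: "?\<psi> \<in> carrier_vec (N * 2 * ?W)" using initial_state_carrier[OF A(1)] by (simp add: qdt_dim_def)
  have v: "?v Z \<in> carrier_vec ?d" for Z
    by (rule carrier_vecI) (simp only: dim_mult_mat_vec oracle_mat_def dim_row_mat qdt_dim_def)
  have "qdt_final_state N (bits_of N (X \<union> Z)) A $ j = (\<Sum>r<?d. U $$ (j, r) * ?v Z $ r)" if "j < ?d" for j Z
  proof -
    have "qdt_final_state N (bits_of N (X \<union> Z)) A = U *\<^sub>v ?v Z"
      by (simp add: qdt_final_state_def initial_state_def steps)
    moreover have "row U j \<bullet> u = (\<Sum>r<?d. U $$ (j, r) * u $ r)" if "u \<in> carrier_vec ?d" for u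
      using that \<open>j < ?d\<close> U(2) by (auto simp: scalar_prod_def lessThan_atLeast0 intro!: sum.cong)
    ultimately show ?thesis using that U(2) v[of Z] by (metis carrier_matD(1) index_mult_mat_vec)
  qed
  then have "(\<Sum>j<?d. potential S (\<lambda>Z. g Z * qdt_final_state N (bits_of N (X \<union> Z)) A $ j))
      = (\<Sum>j<?d. potential S (\<lambda>Z. g Z * (\<Sum>r<?d. U $$ (j, r) * ?v Z $ r)))" by simp
  also have "\<dots> = (\<Sum>r<?d. potential S (\<lambda>Z. g Z * ?v Z $ r))" by (rule potential_unitary[OF U(1)])
  also have "\<dots> = (\<Sum>i<N. \<Sum>w<?W. \<Sum>b\<in>UNIV. potential S (\<lambda>Z. g Z * ?v Z $ basis_index ?W i b w))"
    by (simp add: qdt_dim_def sum_basis_index)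
  also have "\<dots> \<le> (\<Sum>i<N. \<Sum>w<?W. (if i \<in> S then 4 else 1) * ?n i w * potential S g)"
  proof (intro sum_mono)
    fix i w assume "i \<in> {..<N}" "w \<in> {..<?W}"
    then have iw: "i < N" "w < ?W" by auto
    define p q where "p = ?\<psi> $ basis_index ?W i False w" and "q = ?\<psi> $ basis_index ?W i True w"
    have n: "?n i w = (cmod p)\<^sup>2 + (cmod q)\<^sup>2" by (simp add: p_def q_def UNIV_bool add.commute)
    have e: "?v Z $ basis_index ?W i b w = (if b \<noteq> (i \<in> X \<union> Z) then q else p)" for Z b
      unfolding oracle_mat_mult_vec[OF iw \<psi>] using iw(1)
      by (cases b; cases "i \<in> X \<union> Z") (simp_all add: bits_of_def p_def q_def)
    show "(\<Sum>b\<in>UNIV. potential S (\<lambda>Z. g Z * ?v Z $ basis_index ?W i b w))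
        \<le> (if i \<in> S then 4 else 1) * ?n i w * potential S g"
    proof (cases "i \<in> S")
      case True
      then have "i \<notin> X" using S by auto
      then show ?thesis unfolding e n using potential_query_inside[OF \<open>finite S\<close> True, of g q p] True by simp
    next
      case False
      have "potential S (\<lambda>Z. g Z * (if b \<noteq> (i \<in> X \<union> Z) then q else p))
          = potential S (\<lambda>Z. g Z * (if b \<noteq> (i \<in> X) then q else p))" for b
        unfolding potential_def fourier_def using False
        by (intro sum.cong refl arg_cong2[where f = "(*)"] arg_cong[where f = "\<lambda>u. (cmod u)\<^sup>2"]) auto
      then show ?thesis unfolding e n using potential_query_outside[of S g "i \<in> X" q p] False by simp
    qed
  qed
  also have "\<dots> = (\<Sum>i<N. (if i \<in> S then 4 else 1) * query_weight N A i) * potential S g"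
  proof -
    have "query_weight N A i = (\<Sum>w<?W. ?n i w)" for i using q by (simp add: query_weight_def)
    then show ?thesis by (simp only: sum_distrib_left sum_distrib_right)
  qed
  also have "(\<Sum>i<N. (if i \<in> S then 4 else 1) * query_weight N A i)
      = (\<Sum>i<N. query_weight N A i) + 3 * (\<Sum>i<N. if i \<in> S then query_weight N A i else 0)"
    unfolding sum_distrib_left sum.distrib[symmetric] by (intro sum.cong) auto
  also have "(\<Sum>i<N. if i \<in> S then query_weight N A i else 0) = (\<Sum>i\<in>S. query_weight N A i)"
    using S by (simp add: sum.If_cases Int_absorb1)
  also have "((\<Sum>i<N. query_weight N A i) + 3 * (\<Sum>i\<in>S. query_weight N A i)) * potential S g
      \<le> (1 + 3 * (\<Sum>i\<in>S. query_weight N A i)) * potential S g"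
    using sum_query_weight[OF A(1,3)] A(2) by (intro mult_right_mono potential_nonneg) linarith
  finally show ?thesis .
qed


section \<open>Leaves of a hybrid tree\<close>

text \<open>A leaf is represented by its amplitude as a function of the input, the query weight collected
  by each input position along the path, and its label.\<close>

type_synonym 'b leaf = "(bool list \<Rightarrow> complex) \<times> (nat \<Rightarrow> real) \<times> 'b"

definition extend_leaf :: "nat \<Rightarrow> qdt \<Rightarrow> nat \<Rightarrow> 'b leaf \<Rightarrow> 'b leaf" where
  "extend_leaf N A j = (\<lambda>(f, q, y). (\<lambda>x. qdt_final_state N x A $ j * f x, \<lambda>i. query_weight N A i + q i, y))"

primrec leaves :: "nat \<Rightarrow> 'b hybrid_tree \<Rightarrow> 'b leaf list" where
  "leaves N (Leaf y) = [(\<lambda>_. 1, \<lambda>_. 0, y)]"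
| "leaves N (Node A ts) =
     concat (map (\<lambda>j. map (extend_leaf N A j) (map (leaves N) ts ! j)) [0..<length ts])"

abbreviation amplitude :: "'b leaf \<Rightarrow> bool list \<Rightarrow> complex" where "amplitude \<equiv> fst"
abbreviation weight :: "'b leaf \<Rightarrow> nat \<Rightarrow> real" where "weight l \<equiv> fst (snd l)"
abbreviation label :: "'b leaf \<Rightarrow> 'b" where "label l \<equiv> snd (snd l)"

lemma extend_leaf_simps [simp]:
  "amplitude (extend_leaf N A j l) = (\<lambda>x. qdt_final_state N x A $ j * amplitude l x)"
  "weight (extend_leaf N A j l) = (\<lambda>i. query_weight N A i + weight l i)"
  "label (extend_leaf N A j l) = label l"
  by (simp_all add: extend_leaf_def case_prod_unfold)

lemma sum_list_concat_upt: "sum_list (concat (map f [0..<n])) = (\<Sum>j<n. sum_list (f j))"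
  for f :: "nat \<Rightarrow> real list"
  by (induction n) auto

lemma sum_leaves_Node:
  "(\<Sum>l\<leftarrow>leaves N (Node A ts). F l) = (\<Sum>j<length ts. \<Sum>l\<leftarrow>leaves N (ts ! j). F (extend_leaf N A j l) :: real)"
proof -
  have "(\<Sum>l\<leftarrow>leaves N (Node A ts). F l)
      = (\<Sum>j<length ts. \<Sum>l\<leftarrow>map (extend_leaf N A j) (map (leaves N) ts ! j). F l)"
    unfolding sum_list_concat_upt[symmetric] by (simp add: map_concat comp_def)
  then show ?thesis by (simp add: comp_def)
qed

text \<open>Every node is measured, so different leaves do not interfere: the probability of a path
  is the squared modulus of the product of its amplitudes.\<close>

lemma hybrid_output_prob_leaves:
  "hybrid_output_prob N x y T = (\<Sum>l\<leftarrow>leaves N T. (cmod (amplitude l x))\<^sup>2 * of_bool (label l = y))"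
proof (induction T)
  case (Node A ts)
  have "hybrid_output_prob N x y (Node A ts)
      = (\<Sum>j<length ts. qdt_prob N x A j * hybrid_output_prob N x y (ts ! j))" by simp
  also have "\<dots> = (\<Sum>j<length ts. qdt_prob N x A j
      * (\<Sum>l\<leftarrow>leaves N (ts ! j). (cmod (amplitude l x))\<^sup>2 * of_bool (label l = y)))"
    using Node by (intro sum.cong refl) simp
  also have "\<dots> = (\<Sum>l\<leftarrow>leaves N (Node A ts). (cmod (amplitude l x))\<^sup>2 * of_bool (label l = y))"
    unfolding sum_leaves_Node
    by (simp add: qdt_prob_def norm_mult power_mult_distrib sum_list_const_mult mult.assoc)
  finally show ?case .
qed simp

lemma weight_leaves_nonneg: "l \<in> set (leaves N T) \<Longrightarrow> weight l i \<ge> 0"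
proof (induction T arbitrary: l)
  case (Node A ts)
  then obtain j l' where "j < length ts" "l' \<in> set (leaves N (ts ! j))" "l = extend_leaf N A j l'" by auto
  then show ?case using Node.IH[of "ts ! j" l'] query_weight_nonneg[of N A i] by simp
qed simp

lemma finite_hybrid_path_costs: "finite (hybrid_path_costs T)"
  by (induction T) auto

text \<open>A leaf does not record its path, so the induction carries the cost of that path as the
  witness \<open>c\<close>.\<close>

lemma sum_weight_leaves:
  assumes "hybrid_wf N T" "N > 0" "l \<in> set (leaves N T)"
  shows "\<exists>c\<in>hybrid_path_costs T. (\<Sum>i<N. weight l i) \<le> real c"
  using assms
proof (induction T arbitrary: l)
  case (Node A ts)
  then obtain j l' where l: "j < length ts" "l' \<in> set (leaves N (ts ! j))" "l = extend_leaf N A j l'" by auto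
  moreover have "hybrid_wf N (ts ! j)" using Node.prems l(1) by (simp add: list_all_length)
  ultimately obtain c where c: "c \<in> hybrid_path_costs (ts ! j)" "(\<Sum>i<N. weight l' i) \<le> real c"
    using Node.IH[of "ts ! j" l'] Node.prems by auto
  have "(\<Sum>i<N. query_weight N A i) \<le> qdt_queries A" using Node.prems by (intro sum_query_weight) auto
  then have "(\<Sum>i<N. weight l i) \<le> real (qdt_queries A + c)" using c(2) by (simp add: l(3) sum.distrib)
  moreover have "qdt_queries A + c \<in> hybrid_path_costs (Node A ts)"
    using c(1) nth_mem[OF l(1)] by auto
  ultimately show ?case by blast
qed simp

lemma sum_weight_le_cost:
  assumes "hybrid_wf N T" "N > 0" "l \<in> set (leaves N T)"
  shows "(\<Sum>i<N. weight l i) \<le> hybrid_cost T"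
  using sum_weight_leaves[OF assms] Max_ge[OF finite_hybrid_path_costs[of T]]
  unfolding hybrid_cost_def by (metis of_nat_le_iff order_trans)

text \<open>The exponential discount absorbs the growth 1 + 3w of each step, as 1 + 3w is at most
  exp (3w). The discounted potential is thus a supermartingale along the tree. The prefix
  \<open>g\<close> is arbitrary for the sake of the induction.\<close>

lemma potential_leaves:
  assumes "hybrid_wf N T" "hybrid_limited 1 T" "N > 0" and S: "S \<subseteq> {..<N}" "X \<inter> S = {}"
  shows "(\<Sum>l\<leftarrow>leaves N T. exp (- 3 * (\<Sum>i\<in>S. weight l i)) *
      potential S (\<lambda>Z. g Z * amplitude l (bits_of N (X \<union> Z)))) \<le> potential S g"
  using assms(1,2)
proof (induction T arbitrary: g)
  case (Node A ts)
  let ?q = "\<Sum>i\<in>S. query_weight N A i"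
  let ?g = "\<lambda>j Z. g Z * qdt_final_state N (bits_of N (X \<union> Z)) A $ j"
  have A: "qdt_wf N A" "qdt_queries A \<le> 1" "length ts = qdt_dim N A" using Node.prems by auto
  have "?q \<ge> 0" by (intro sum_nonneg query_weight_nonneg)
  have exp: "exp (- 3 * ?q) * (1 + 3 * ?q) \<le> 1"
    using exp_ge_add_one_self[of "3 * ?q"] by (simp add: exp_minus field_simps)
  have split: "exp (- 3 * (\<Sum>i\<in>S. query_weight N A i + q i)) = exp (- 3 * ?q) * exp (- 3 * (\<Sum>i\<in>S. q i))" for q
    by (simp add: sum.distrib distrib_left flip: exp_add)
  have "(\<Sum>l\<leftarrow>leaves N (Node A ts). exp (- 3 * (\<Sum>i\<in>S. weight l i)) *
        potential S (\<lambda>Z. g Z * amplitude l (bits_of N (X \<union> Z))))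
      = (\<Sum>j<length ts. exp (- 3 * ?q) * (\<Sum>l\<leftarrow>leaves N (ts ! j). exp (- 3 * (\<Sum>i\<in>S. weight l i)) *
        potential S (\<lambda>Z. ?g j Z * amplitude l (bits_of N (X \<union> Z)))))"
    unfolding sum_leaves_Node extend_leaf_simps split mult.assoc sum_list_const_mult ..
  also have "\<dots> \<le> (\<Sum>j<length ts. exp (- 3 * ?q) * potential S (?g j))"
  proof (intro sum_mono mult_left_mono)
    fix j assume "j \<in> {..<length ts}"
    then have j: "j < length ts" by simp
    show "(\<Sum>l\<leftarrow>leaves N (ts ! j). exp (- 3 * (\<Sum>i\<in>S. weight l i)) *
        potential S (\<lambda>Z. ?g j Z * amplitude l (bits_of N (X \<union> Z)))) \<le> potential S (?g j)"
      using Node.prems j by (intro Node.IH) (auto simp: list_all_length)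
  qed simp
  also have "\<dots> = exp (- 3 * ?q) * (\<Sum>j<qdt_dim N A. potential S (?g j))"
    by (simp add: A(3) sum_distrib_left)
  also have "\<dots> \<le> exp (- 3 * ?q) * ((1 + 3 * ?q) * potential S g)"
    using A assms(3) S by (intro mult_left_mono potential_step) auto
  also have "\<dots> = (exp (- 3 * ?q) * (1 + 3 * ?q)) * potential S g" by simp
  also have "\<dots> \<le> 1 * potential S g" by (intro mult_right_mono exp potential_nonneg)
  finally show ?case by simp
qed simp

text \<open>For \<open>S = {}\<close> the discount is 1 and the potential is the squared
  amplitude.\<close>

lemma sum_leaves_le_1:
  assumes "hybrid_wf N T" "hybrid_limited 1 T" "N > 0"
  shows "(\<Sum>l\<leftarrow>leaves N T. (cmod (amplitude l (bits_of N X)))\<^sup>2) \<le> 1"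
  using potential_leaves[OF assms, of "{}" X "\<lambda>_. 1"] by (simp add: potential_empty)

text \<open>On a light leaf the discount is at least exp (-3), which is the source of the
  constant.\<close>

lemma sum_bias_le:
  assumes T: "hybrid_wf N T" "hybrid_limited 1 T" "N > 0" and S: "S \<subseteq> {..<N}" "X \<inter> S = {}"
  shows "(\<Sum>l\<leftarrow>leaves N T. of_bool ((\<Sum>i\<in>S. weight l i) \<le> 1) *
    cmod (\<Sum>Z\<in>Pow S. (cmod (amplitude l (bits_of N (X \<union> Z))))\<^sup>2 * walsh S Z)) \<le> exp 3"
    (is "(\<Sum>l\<leftarrow>_. of_bool (?light l) * cmod (?bias l)) \<le> _")
proof -
  let ?pot = "\<lambda>l. potential S (\<lambda>Z. amplitude l (bits_of N (X \<union> Z)))"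
  have "finite S" using S(1) finite_subset by auto
  have "4 ^ card S * (\<Sum>l\<leftarrow>leaves N T. of_bool (?light l) * cmod (?bias l))
      = (\<Sum>l\<leftarrow>leaves N T. of_bool (?light l) * (4 ^ card S * cmod (?bias l)))"
    by (simp add: mult.left_commute flip: sum_list_const_mult)
  also have "\<dots> \<le> (\<Sum>l\<leftarrow>leaves N T. exp 3 * (exp (- 3 * (\<Sum>i\<in>S. weight l i)) * ?pot l))"
  proof (intro sum_list_mono)
    fix l assume "l \<in> set (leaves N T)"
    have "of_bool (?light l) * (4 ^ card S * cmod (?bias l)) \<le> of_bool (?light l) * ?pot l"
      using bias_le_potential[OF \<open>finite S\<close>] by (intro mult_left_mono) auto
    also have "\<dots> \<le> exp (3 - 3 * (\<Sum>i\<in>S. weight l i)) * ?pot l"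
      by (intro mult_right_mono potential_nonneg) auto
    also have "\<dots> = exp 3 * (exp (- 3 * (\<Sum>i\<in>S. weight l i)) * ?pot l)"
      by (simp add: exp_diff exp_minus field_simps)
    finally show "of_bool (?light l) * (4 ^ card S * cmod (?bias l))
        \<le> exp 3 * (exp (- 3 * (\<Sum>i\<in>S. weight l i)) * ?pot l)" .
  qed
  also have "\<dots> = exp 3 * (\<Sum>l\<leftarrow>leaves N T. exp (- 3 * (\<Sum>i\<in>S. weight l i)) * ?pot l)"
    by (simp add: sum_list_const_mult)
  also have "\<dots> \<le> exp 3 * 4 ^ card S"
    using potential_leaves[OF T S, of "\<lambda>_. 1"] potential_1[OF \<open>finite S\<close>] by simp
  finally show ?thesis by (simp add: mult.commute)
qed


section \<open>Inputs with prescribed block parities\<close>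

definition blk :: "nat \<Rightarrow> nat \<Rightarrow> nat set" where
  "blk m p = {p * m..<p * m + m}"

text \<open>The fibre of \<open>Y\<close> under blockwise parity: the inputs of the composed
  function that present \<open>Y\<close> to the outer function.\<close>

definition inputs :: "nat \<Rightarrow> nat \<Rightarrow> nat set \<Rightarrow> nat set set" where
  "inputs n m Y = {X. X \<subseteq> {..<n * m} \<and> (\<forall>p<n. odd (card (X \<inter> blk m p)) \<longleftrightarrow> p \<in> Y)}"

text \<open>What remains of such inputs when block \<open>p\<close> is erased. This set is the same
  for \<open>Y\<close> and \<open>flip p Y\<close>, so their fibres can be compared block content by
  block content.\<close>

definition outer_inputs :: "nat \<Rightarrow> nat \<Rightarrow> nat \<Rightarrow> nat set \<Rightarrow> nat set set" where
  "outer_inputs n m p Y = {X. X \<subseteq> {..<n * m} - blk m p \<and>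
     (\<forall>j<n. j \<noteq> p \<longrightarrow> (odd (card (X \<inter> blk m j)) \<longleftrightarrow> j \<in> Y))}"

lemma blk_subset: "p < n \<Longrightarrow> blk m p \<subseteq> {..<n * m}"
proof -
  assume "p < n"
  then have "(p + 1) * m \<le> n * m" by (intro mult_right_mono) auto
  then show ?thesis by (auto simp: blk_def)
qed

lemma blk_disjoint: "p \<noteq> j \<Longrightarrow> blk m p \<inter> blk m j = {}"
proof -
  have "p' = j'" if "x \<in> blk m p'" "x \<in> blk m j'" for x p' j'
  proof -
    have "x div m = p''" if "x \<in> blk m p''" for p''
      using that by (auto simp: blk_def mult.commute intro!: div_nat_eqI)
    then show ?thesis using that by blast
  qed
  moreover assume "p \<noteq> j"
  ultimately show ?thesis by blast
qed

lemma finite_inputs [simp]: "finite (inputs n m Y)"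
  by (rule finite_subset[of _ "Pow {..<n * m}"]) (auto simp: inputs_def)

lemma finite_outer_inputs [simp]: "finite (outer_inputs n m p Y)"
  by (rule finite_subset[of _ "Pow {..<n * m}"]) (auto simp: outer_inputs_def)

lemma outer_inputs_flip [simp]: "outer_inputs n m p (flip p Y) = outer_inputs n m p Y"
  by (auto simp: outer_inputs_def flip_def)

lemma mem_flip [simp]: "p \<in> flip p Y \<longleftrightarrow> p \<notin> Y"
  by (auto simp: flip_def)

lemma sum_inputs_split:
  fixes h :: "nat set \<Rightarrow> real"
  assumes "p < n"
  shows "(\<Sum>X\<in>inputs n m Y. h X)
    = (\<Sum>X\<in>outer_inputs n m p Y. \<Sum>Z\<in>Pow (blk m p). of_bool (odd (card Z) \<longleftrightarrow> p \<in> Y) * h (X \<union> Z))"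
proof -
  let ?Q = "{Z \<in> Pow (blk m p). odd (card Z) \<longleftrightarrow> p \<in> Y}"
  have outer: "(X \<union> Z) \<inter> blk m j = X \<inter> blk m j" if "Z \<subseteq> blk m p" "j \<noteq> p" for X Z j
    using that blk_disjoint[of j p m] by blast
  have "(\<Sum>X\<in>inputs n m Y. h X) = (\<Sum>(X, Z)\<in>outer_inputs n m p Y \<times> ?Q. h (X \<union> Z))"
  proof (rule sum.reindex_bij_witness[of _ "\<lambda>(X, Z). X \<union> Z" "\<lambda>X. (X - blk m p, X \<inter> blk m p)"])
    fix X assume X: "X \<in> inputs n m Y"
    then have "(X - blk m p) \<inter> blk m j = X \<inter> blk m j" if "j \<noteq> p" for j
      using that blk_disjoint[of j p m] by blast
    then show "(X - blk m p, X \<inter> blk m p) \<in> outer_inputs n m p Y \<times> ?Q"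
      using X assms by (auto simp: inputs_def outer_inputs_def)
  next
    fix XZ assume "XZ \<in> outer_inputs n m p Y \<times> ?Q"
    then obtain X Z where XZ: "XZ = (X, Z)" "X \<in> outer_inputs n m p Y" "Z \<subseteq> blk m p" "odd (card Z) \<longleftrightarrow> p \<in> Y"
      by auto
    moreover have "X \<inter> blk m p = {}" using XZ(2) by (auto simp: outer_inputs_def)
    then have "(X \<union> Z) \<inter> blk m p = Z" using XZ(3) by auto
    ultimately show "(case XZ of (X, Z) \<Rightarrow> X \<union> Z) \<in> inputs n m Y"
      using blk_subset[OF assms, of m] outer[OF XZ(3), of _ X]
      by (auto simp: inputs_def outer_inputs_def) metis+
    show "((case XZ of (X, Z) \<Rightarrow> X \<union> Z) - blk m p, (case XZ of (X, Z) \<Rightarrow> X \<union> Z) \<inter> blk m p) = XZ"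
      using XZ \<open>X \<inter> blk m p = {}\<close> by auto
  qed (auto simp: Un_Diff_Int)
  also have "\<dots> = (\<Sum>X\<in>outer_inputs n m p Y. \<Sum>Z\<in>?Q. h (X \<union> Z))"
    by (simp add: sum.cartesian_product)
  also have "\<dots> = (\<Sum>X\<in>outer_inputs n m p Y. \<Sum>Z\<in>Pow (blk m p). of_bool (odd (card Z) \<longleftrightarrow> p \<in> Y) * h (X \<union> Z))"
    by (intro sum.cong refl sum.mono_neutral_cong_left) (auto simp: blk_def)
  finally show ?thesis .
qed

lemma sum_alternating_card:
  fixes S :: "nat set"
  assumes "finite S" "S \<noteq> {}"
  shows "(\<Sum>Z\<in>Pow S. (-1) ^ card Z) = (0 :: real)"
proof -
  have "complex_of_real (\<Sum>Z\<in>Pow S. (-1) ^ card Z) = (\<Sum>Z\<in>Pow S. walsh Z S)"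
    by (simp add: walsh_def) (intro sum.cong, auto simp: Int_absorb2)
  also have "\<dots> = 0" using assms by (intro sum_walsh_eq_0) auto
  finally show ?thesis by (simp only: of_real_eq_0_iff)
qed

lemma card_inputs:
  assumes "p < n" "m > 0"
  shows "real (card (inputs n m Y)) = real (card (outer_inputs n m p Y)) * 2 ^ m / 2"
proof -
  have S: "finite (blk m p)" "blk m p \<noteq> {}" "card (blk m p) = m" using assms by (auto simp: blk_def)
  have "real (card (inputs n m Y)) = (\<Sum>X\<in>inputs n m Y. 1)" by simp
  also have "\<dots> = (\<Sum>X\<in>outer_inputs n m p Y. \<Sum>Z\<in>Pow (blk m p). of_bool (odd (card Z) \<longleftrightarrow> p \<in> Y))"
    by (subst sum_inputs_split[OF assms(1)]) simp
  \<comment> \<open>The indicator of a parity is (1 + s)/2 with a sign s, and the signs cancel over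
    the subsets of a nonempty block.\<close>
  also have "(\<Sum>Z\<in>Pow (blk m p). of_bool (odd (card Z) \<longleftrightarrow> p \<in> Y) :: real)
      = (\<Sum>Z\<in>Pow (blk m p). 1 / 2 + (if p \<in> Y then - (1 / 2) else 1 / 2) * (-1) ^ card Z)"
    by (intro sum.cong refl) (auto simp: uminus_power_if)
  also have "\<dots> = 2 ^ m / 2"
    using S by (simp add: sum.distrib sum_alternating_card card_Pow flip: sum_distrib_left)
  finally show ?thesis by simp
qed

text \<open>All fibres have the same size, so a single number normalises the uniform distributions
  on them.\<close>

lemma card_inputs_eq:
  assumes "Y \<subseteq> {..<n}" "m > 0"
  shows "card (inputs n m Y) = card (inputs n m {})"
proof -
  have "finite Y" using assms finite_subset by auto
  then show ?thesis using assms(1)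
  proof induction
    case (insert p Y)
    then have "insert p Y = flip p Y" "p < n" by (auto simp: flip_def)
    then have "real (card (inputs n m (insert p Y))) = real (card (inputs n m Y))"
      using card_inputs[of p n m "flip p Y"] card_inputs[of p n m Y] assms(2) by simp
    then show ?case using insert by simp
  qed simp
qed

lemma card_inputs_pos: "card (inputs n m {}) > 0"
proof -
  have "{} \<in> inputs n m {}" by (simp add: inputs_def)
  then show ?thesis by (auto simp: card_gt_0_iff)
qed

text \<open>For a fixed outer part the two indicators are complementary, and their difference is the
  parity character of the block up to a global sign. This is the bias bounded above.\<close>

lemma sum_inputs_diff_flip:
  fixes h :: "nat set \<Rightarrow> real"
  assumes "p < n"
  shows "\<bar>(\<Sum>X\<in>inputs n m Y. h X) - (\<Sum>X\<in>inputs n m (flip p Y). h X)\<bar>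
    \<le> (\<Sum>X\<in>outer_inputs n m p Y. \<bar>\<Sum>Z\<in>Pow (blk m p). h (X \<union> Z) * (-1) ^ card Z\<bar>)"
proof -
  let ?s = "if p \<in> Y then -1 else 1 :: real"
  have "(\<Sum>X\<in>inputs n m Y. h X) - (\<Sum>X\<in>inputs n m (flip p Y). h X)
      = (\<Sum>X\<in>outer_inputs n m p Y. \<Sum>Z\<in>Pow (blk m p).
          of_bool (odd (card Z) \<longleftrightarrow> p \<in> Y) * h (X \<union> Z) - of_bool (odd (card Z) \<longleftrightarrow> p \<notin> Y) * h (X \<union> Z))"
    by (simp add: sum_inputs_split[OF assms] sum_subtractf)
  also have "\<dots> = (\<Sum>X\<in>outer_inputs n m p Y. \<Sum>Z\<in>Pow (blk m p). ?s * (h (X \<union> Z) * (-1) ^ card Z))"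
    by (intro sum.cong refl) (auto simp: uminus_power_if)
  also have "\<dots> = ?s * (\<Sum>X\<in>outer_inputs n m p Y. \<Sum>Z\<in>Pow (blk m p). h (X \<union> Z) * (-1) ^ card Z)"
    by (simp only: sum_distrib_left)
  finally have "\<bar>(\<Sum>X\<in>inputs n m Y. h X) - (\<Sum>X\<in>inputs n m (flip p Y). h X)\<bar>
      = \<bar>\<Sum>X\<in>outer_inputs n m p Y. \<Sum>Z\<in>Pow (blk m p). h (X \<union> Z) * (-1) ^ card Z\<bar>"
    by (simp add: abs_mult)
  then show ?thesis by (simp add: sum_abs)
qed


section \<open>Transcripts that cannot see the parity of a light block\<close>

text \<open>All that is kept of the tree: \<open>l\<close> is a leaf, \<open>P\<close> its
  probability on an input, \<open>q\<close> its query weights, \<open>D\<close> the bound on the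
  total bias. From here on the argument is purely combinatorial.\<close>

locale transcripts =
  fixes n m :: nat and I :: "'l set" and P :: "'l \<Rightarrow> nat set \<Rightarrow> real"
    and q :: "'l \<Rightarrow> nat \<Rightarrow> real" and D :: real
  assumes m_pos: "m > 0"
    and finite_I: "finite I"
    and P_nonneg: "P l X \<ge> 0"
    and P_sum: "(\<Sum>l\<in>I. P l X) \<le> 1"
    and q_nonneg: "l \<in> I \<Longrightarrow> q l i \<ge> 0"
    and bias: "S \<subseteq> {..<n * m} \<Longrightarrow> X \<inter> S = {} \<Longrightarrow>
      (\<Sum>l\<in>I. of_bool ((\<Sum>i\<in>S. q l i) \<le> 1) * \<bar>\<Sum>Z\<in>Pow S. P l (X \<union> Z) * (-1) ^ card Z\<bar>) \<le> D"
begin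

definition light :: "'l \<Rightarrow> nat set \<Rightarrow> bool" where
  "light l S \<longleftrightarrow> (\<Sum>i\<in>S. q l i) \<le> 1"

definition mass :: "'l \<Rightarrow> nat set \<Rightarrow> real" where
  "mass l Y = (\<Sum>X\<in>inputs n m Y. P l X)"

definition count :: real where
  "count = real (card (inputs n m {}))"

text \<open>The bound \<open>D\<close> once for each outer input, of which there are 2 *
  \<open>count\<close> / 2 ^ m. Masses are sums over a fibre, not averages, hence the factor
  \<open>count\<close>.\<close>

definition flip_error :: real where
  "flip_error = 2 * count * D / 2 ^ m"

lemma mass_nonneg: "mass l Y \<ge> 0"
  unfolding mass_def by (intro sum_nonneg P_nonneg)

lemma D_nonneg: "D \<ge> 0"
  using bias[of "{}" "{}"] by (rule order_trans[rotated]) (auto intro: sum_nonneg)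

lemma flip_error_nonneg: "flip_error \<ge> 0"
  using D_nonneg by (simp add: flip_error_def count_def)

lemma light_mono:
  assumes "l \<in> I" "light l S" "S' \<subseteq> S" "finite S"
  shows "light l S'"
  using sum_mono2[of S S' "q l"] assms q_nonneg unfolding light_def by fastforce

lemma mass_flip:
  assumes "p < n" "Y \<subseteq> {..<n}"
  shows "(\<Sum>l\<in>I. of_bool (light l (blk m p)) * \<bar>mass l Y - mass l (flip p Y)\<bar>) \<le> flip_error"
proof -
  let ?B = "\<lambda>l X. \<bar>\<Sum>Z\<in>Pow (blk m p). P l (X \<union> Z) * (-1) ^ card Z\<bar>"
  have "(\<Sum>l\<in>I. of_bool (light l (blk m p)) * \<bar>mass l Y - mass l (flip p Y)\<bar>)
      \<le> (\<Sum>l\<in>I. of_bool (light l (blk m p)) * (\<Sum>X\<in>outer_inputs n m p Y. ?B l X))"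
    unfolding mass_def by (intro sum_mono mult_left_mono sum_inputs_diff_flip assms) auto
  also have "\<dots> = (\<Sum>X\<in>outer_inputs n m p Y. \<Sum>l\<in>I. of_bool (light l (blk m p)) * ?B l X)"
    unfolding sum_distrib_left by (rule sum.swap)
  also have "\<dots> \<le> (\<Sum>X\<in>outer_inputs n m p Y. D)"
    unfolding light_def
    by (intro sum_mono bias blk_subset assms) (auto simp: outer_inputs_def)
  also have "\<dots> = flip_error"
    using card_inputs[OF assms(1) m_pos, of Y] card_inputs_eq[OF assms(2) m_pos]
    by (simp add: flip_error_def count_def field_simps)
  finally show ?thesis .
qed

text \<open>Triangle inequality along a path that corrects the positions in \<open>E\<close> one at
  a time.\<close>

lemma mass_change:
  assumes "finite E" "E \<subseteq> {..<n}" "Y \<subseteq> {..<n}" "Y' \<subseteq> {..<n}" "\<And>p. p \<notin> E \<Longrightarrow> p \<in> Y \<longleftrightarrow> p \<in> Y'"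
  shows "(\<Sum>l\<in>I. of_bool (\<forall>p\<in>E. light l (blk m p)) * \<bar>mass l Y - mass l Y'\<bar>) \<le> card E * flip_error"
  using assms
proof (induction E arbitrary: Y)
  case empty
  then have "Y = Y'" by auto
  then show ?case by simp
next
  case (insert p E)
  define Y'' where "Y'' = (if p \<in> Y \<longleftrightarrow> p \<in> Y' then Y else flip p Y)"
  have p: "p < n" using insert by auto
  have Y'': "Y'' \<subseteq> {..<n}" using insert.prems by (auto simp: Y''_def flip_def)
  have agree: "r \<in> Y'' \<longleftrightarrow> r \<in> Y'" if "r \<notin> E" for r
    using that insert.prems(4)[of r] by (cases "r = p") (auto simp: Y''_def flip_def)
  have 1: "(\<Sum>l\<in>I. of_bool (light l (blk m p)) * \<bar>mass l Y - mass l Y''\<bar>) \<le> flip_error"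
    using mass_flip[OF p insert.prems(2)] flip_error_nonneg by (simp add: Y''_def)
  have 2: "(\<Sum>l\<in>I. of_bool (\<forall>p\<in>E. light l (blk m p)) * \<bar>mass l Y'' - mass l Y'\<bar>) \<le> card E * flip_error"
    using insert.prems Y'' agree by (intro insert.IH) auto
  have "(\<Sum>l\<in>I. of_bool (\<forall>p\<in>insert p E. light l (blk m p)) * \<bar>mass l Y - mass l Y'\<bar>)
      \<le> (\<Sum>l\<in>I. of_bool (light l (blk m p)) * \<bar>mass l Y - mass l Y''\<bar>
        + of_bool (\<forall>p\<in>E. light l (blk m p)) * \<bar>mass l Y'' - mass l Y'\<bar>)"
    by (intro sum_mono) (auto simp: of_bool_def)
  also have "\<dots> \<le> flip_error + card E * flip_error" using 1 2 by (simp add: sum.distrib)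
  also have "\<dots> = card (insert p E) * flip_error" using insert by (simp add: algebra_simps)
  finally show ?case .
qed

end


section \<open>Hiding a period in a permutation\<close>

text \<open>The positions of the ones in the Boolean encoding of the values of \<open>z\<close>; the
  reversed bit index puts the most significant bit first, as in \<open>nat_of_bits\<close>.\<close>

definition code :: "nat \<Rightarrow> (nat \<Rightarrow> nat) \<Rightarrow> nat set" where
  "code k z = {p. p < 2 ^ k * k \<and> bit (z (p div k)) (k - 1 - p mod k)}"

text \<open>Interpolates between \<pi> at \<open>p = 0\<close> and an input with period
  \<open>a\<close> at \<open>p = 2 ^ k\<close>: a pair whose smaller member is below
  \<open>p\<close> already carries the value of that member twice.\<close>

definition merged :: "nat \<Rightarrow> nat \<Rightarrow> (nat \<Rightarrow> nat) \<Rightarrow> nat \<Rightarrow> nat" where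
  "merged a p \<pi> j =
     (if min j (Bit_Operations.xor j a) < p then \<pi> (min j (Bit_Operations.xor j a)) else \<pi> j)"

lemma xor_xor_cancel [simp]: "Bit_Operations.xor (Bit_Operations.xor j a) a = j" for j a :: nat
  by (simp add: xor.assoc)

lemma xor_eq_iff: "Bit_Operations.xor i j = a \<longleftrightarrow> j = Bit_Operations.xor i a" for i j a :: nat
  by (metis xor.left_commute xor.commute xor_xor_cancel)

lemma xor_less: "i < 2 ^ k \<Longrightarrow> a < 2 ^ k \<Longrightarrow> Bit_Operations.xor i a < 2 ^ k" for i a k :: nat
  by (metis take_bit_nat_eq_self_iff take_bit_xor)

lemma merged_0 [simp]: "merged a 0 \<pi> = \<pi>"
  by (simp add: merged_def fun_eq_iff)

text \<open>Here \<open>p\<close> is the larger member of its pair, or \<open>a\<close> is 0, so no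
  new pair is merged.\<close>

lemma merged_Suc_eq:
  assumes "Bit_Operations.xor p a \<le> p"
  shows "merged a (Suc p) \<pi> = merged a p \<pi>"
proof
  fix j
  show "merged a (Suc p) \<pi> j = merged a p \<pi> j"
  proof (cases "min j (Bit_Operations.xor j a) = p")
    case True
    then have "j = p \<or> j = Bit_Operations.xor p a" by (metis min_def xor_xor_cancel)
    then have "j = p" using True assms by auto
    then show ?thesis using True by (simp add: merged_def)
  qed (auto simp: merged_def less_Suc_eq)
qed

lemma merged_Suc_off_partner:
  assumes "j \<noteq> Bit_Operations.xor p a"
  shows "merged a (Suc p) \<pi> j = merged a p \<pi> j"
proof (cases "min j (Bit_Operations.xor j a) = p")
  case True
  then have "j = p" using assms by (metis min_def xor_xor_cancel)
  then show ?thesis using True by (simp add: merged_def)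
qed (auto simp: merged_def less_Suc_eq)

text \<open>After exchanging the two values first, the merged pair carries the value that \<pi> has
  at the partner, so the overwritten index is \<open>p\<close> itself.\<close>

lemma merged_Suc_transpose:
  assumes "j \<noteq> p" "p < Bit_Operations.xor p a"
  shows "merged a (Suc p) (\<pi> \<circ> transpose p (Bit_Operations.xor p a)) j = merged a p \<pi> j"
proof (cases "j = Bit_Operations.xor p a")
  case True
  then show ?thesis using assms by (simp add: merged_def)
next
  case False
  then have "Bit_Operations.xor j a \<noteq> p" "Bit_Operations.xor j a \<noteq> Bit_Operations.xor p a"
    using assms by (metis xor_xor_cancel)+
  then show ?thesis using assms False by (auto simp: merged_def less_Suc_eq min_def)
qed

locale simon_transcripts = transcripts "2 ^ k * k" m I P q D
  for k m :: nat and I :: "'l set" and P q D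
begin

definition light_index :: "'l \<Rightarrow> nat \<Rightarrow> bool" where
  "light_index l i \<longleftrightarrow> light l (blk (k * m) i)"

text \<open>No pair is heavy at both ends, so each merge can overwrite a light member. For
  \<open>a = 0\<close> there are no pairs.\<close>

definition pairwise_light :: "nat \<Rightarrow> 'l \<Rightarrow> bool" where
  "pairwise_light a l \<longleftrightarrow>
     (\<forall>i<2 ^ k. Bit_Operations.xor i a \<noteq> i \<longrightarrow> light_index l i \<or> light_index l (Bit_Operations.xor i a))"

abbreviation perms :: "(nat \<Rightarrow> nat) set" where
  "perms \<equiv> {\<pi>. \<pi> permutes {..<2 ^ k}}"

lemma finite_perms: "finite perms"
  by (simp add: finite_permutations)

text \<open>One value occupies \<open>k\<close> code bits, and the blocks of these bits lie inside
  the light block of index \<open>i\<close>.\<close>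

lemma mass_change_index:
  assumes "i < 2 ^ k" "\<And>j. j \<noteq> i \<Longrightarrow> z j = z' j"
  shows "(\<Sum>l\<in>I. of_bool (light_index l i) * \<bar>mass l (code k z) - mass l (code k z')\<bar>) \<le> k * flip_error"
proof -
  have "(\<Sum>l\<in>I. of_bool (light_index l i) * \<bar>mass l (code k z) - mass l (code k z')\<bar>)
      \<le> (\<Sum>l\<in>I. of_bool (\<forall>p\<in>blk k i. light l (blk m p)) * \<bar>mass l (code k z) - mass l (code k z')\<bar>)"
  proof (intro sum_mono mult_right_mono)
    fix l assume l: "l \<in> I"
    have "light l (blk m p)" if "light_index l i" "p \<in> blk k i" for p
    proof (rule light_mono[OF l])
      show "light l (blk (k * m) i)" using that by (simp add: light_index_def)
      have "i * k \<le> p" "p + 1 \<le> i * k + k" using that(2) by (auto simp: blk_def)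
      then have "i * k * m \<le> p * m" "(p + 1) * m \<le> (i * k + k) * m" by (intro mult_right_mono; simp)+
      then show "blk m p \<subseteq> blk (k * m) i" by (auto simp: blk_def algebra_simps)
    qed (simp add: blk_def)
    then show "of_bool (light_index l i) \<le> (of_bool (\<forall>p\<in>blk k i. light l (blk m p)) :: real)" by auto
  qed auto
  also have "\<dots> \<le> card (blk k i) * flip_error"
  proof (intro mass_change)
    show "blk k i \<subseteq> {..<2 ^ k * k}" by (intro blk_subset assms)
    fix p assume p: "p \<notin> blk k i"
    show "p \<in> code k z \<longleftrightarrow> p \<in> code k z'"
    proof (cases "k = 0")
      case False
      have "p div k \<noteq> i"
      proof
        assume "p div k = i"
        then have "p = i * k + p mod k" by (metis div_mult_mod_eq)
        moreover have "p mod k < k" using False by simp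
        ultimately show False using p by (auto simp: blk_def)
      qed
      then show ?thesis using assms(2) by (simp add: code_def)
    qed (simp add: code_def)
  qed (auto simp: code_def blk_def)
  finally show ?thesis by (simp add: blk_def)
qed

text \<open>If one of the two partners \<open>p\<close>, \<open>p \<oplus> a\<close> is light then its value can be overwritten by that of
  the other partner. Which of the two values survives does not matter after averaging over \<open>\<pi>\<close>.\<close>

lemma merge_step:
  assumes "a < 2 ^ k" "p < 2 ^ k"
  shows "(\<Sum>l\<in>I. of_bool (pairwise_light a l) *
      \<bar>(\<Sum>\<pi>\<in>perms. mass l (code k (merged a p \<pi>))) - (\<Sum>\<pi>\<in>perms. mass l (code k (merged a (Suc p) \<pi>)))\<bar>)
    \<le> 2 * k * flip_error * card perms"
    (is "(\<Sum>l\<in>I. _ * \<bar>?A l - ?B l\<bar>) \<le> _")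
proof (cases "Bit_Operations.xor p a \<le> p")
  case True
  then show ?thesis using flip_error_nonneg by (simp add: merged_Suc_eq)
next
  case False
  let ?p' = "Bit_Operations.xor p a" and ?c = "\<lambda>p \<pi>. code k (merged a p \<pi>)"
  let ?t = "transpose p ?p'"
  have p': "?p' < 2 ^ k" "p < ?p'" using assms False xor_less by auto
  have t: "?t permutes {..<2 ^ k}" using assms p' by (intro permutes_swap_id) auto
  have B: "?B l = (\<Sum>\<pi>\<in>perms. mass l (?c (Suc p) (\<pi> \<circ> ?t)))" for l
    by (rule sum_permutations_compose_right[OF t])
  \<comment> \<open>Each leaf falls under one of two alternatives, overwriting the partner or
    overwriting \<open>p\<close>. Adding both bounds costs the factor 2.\<close>
  have "(\<Sum>l\<in>I. of_bool (pairwise_light a l) * \<bar>?A l - ?B l\<bar>)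
      \<le> (\<Sum>l\<in>I. (\<Sum>\<pi>\<in>perms. of_bool (light_index l ?p') * \<bar>mass l (?c p \<pi>) - mass l (?c (Suc p) \<pi>)\<bar>)
        + (\<Sum>\<pi>\<in>perms. of_bool (light_index l p) * \<bar>mass l (?c p \<pi>) - mass l (?c (Suc p) (\<pi> \<circ> ?t))\<bar>))"
  proof (intro sum_mono)
    fix l
    have 1: "\<bar>?A l - ?B l\<bar> \<le> (\<Sum>\<pi>\<in>perms. \<bar>mass l (?c p \<pi>) - mass l (?c (Suc p) \<pi>)\<bar>)"
      by (simp add: sum_abs flip: sum_subtractf)
    have 2: "\<bar>?A l - ?B l\<bar> \<le> (\<Sum>\<pi>\<in>perms. \<bar>mass l (?c p \<pi>) - mass l (?c (Suc p) (\<pi> \<circ> ?t))\<bar>)"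
      unfolding B by (simp add: sum_abs flip: sum_subtractf)
    have 3: "pairwise_light a l \<Longrightarrow> light_index l ?p' \<or> light_index l p"
      using assms p' unfolding pairwise_light_def by auto
    have 4: "(\<Sum>\<pi>\<in>perms. \<bar>mass l (?c p \<pi>) - mass l (?c (Suc p) \<pi>)\<bar>) \<ge> 0"
      "(\<Sum>\<pi>\<in>perms. \<bar>mass l (?c p \<pi>) - mass l (?c (Suc p) (\<pi> \<circ> ?t))\<bar>) \<ge> 0" by (intro sum_nonneg; simp)+
    show "of_bool (pairwise_light a l) * \<bar>?A l - ?B l\<bar>
      \<le> (\<Sum>\<pi>\<in>perms. of_bool (light_index l ?p') * \<bar>mass l (?c p \<pi>) - mass l (?c (Suc p) \<pi>)\<bar>)
        + (\<Sum>\<pi>\<in>perms. of_bool (light_index l p) * \<bar>mass l (?c p \<pi>) - mass l (?c (Suc p) (\<pi> \<circ> ?t))\<bar>)"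
      unfolding sum_distrib_left[symmetric] using 1 2 3 4 by (auto simp: of_bool_def)
  qed
  also have "\<dots> = (\<Sum>\<pi>\<in>perms. \<Sum>l\<in>I. of_bool (light_index l ?p') * \<bar>mass l (?c p \<pi>) - mass l (?c (Suc p) \<pi>)\<bar>)
      + (\<Sum>\<pi>\<in>perms. \<Sum>l\<in>I. of_bool (light_index l p) * \<bar>mass l (?c p \<pi>) - mass l (?c (Suc p) (\<pi> \<circ> ?t))\<bar>)"
    unfolding sum.distrib by (intro arg_cong2[of _ _ _ _ "(+)"] sum.swap)
  also have "\<dots> \<le> (\<Sum>\<pi>\<in>perms. k * flip_error) + (\<Sum>\<pi>\<in>perms. k * flip_error)"
    using assms p' by (intro add_mono sum_mono mass_change_index)
      (auto simp: merged_Suc_off_partner merged_Suc_transpose)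
  finally show ?thesis by (simp add: algebra_simps)
qed

lemma merge_all:
  assumes "a < 2 ^ k"
  shows "p \<le> 2 ^ k \<Longrightarrow> (\<Sum>l\<in>I. of_bool (pairwise_light a l) *
      \<bar>(\<Sum>\<pi>\<in>perms. mass l (code k \<pi>)) - (\<Sum>\<pi>\<in>perms. mass l (code k (merged a p \<pi>)))\<bar>)
    \<le> p * (2 * k * flip_error * card perms)"
proof (induction p)
  case (Suc p)
  let ?A = "\<lambda>p l. \<Sum>\<pi>\<in>perms. mass l (code k (merged a p \<pi>))"
  have "(\<Sum>l\<in>I. of_bool (pairwise_light a l) * \<bar>?A 0 l - ?A (Suc p) l\<bar>)
      \<le> (\<Sum>l\<in>I. of_bool (pairwise_light a l) * \<bar>?A 0 l - ?A p l\<bar> + of_bool (pairwise_light a l) * \<bar>?A p l - ?A (Suc p) l\<bar>)"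
    by (intro sum_mono) (auto simp: of_bool_def)
  also have "\<dots> \<le> p * (2 * k * flip_error * card perms) + 2 * k * flip_error * card perms"
    unfolding sum.distrib using Suc merge_step[OF assms, of p] by (intro add_mono) auto
  also have "\<dots> = Suc p * (2 * k * flip_error * card perms)" by (simp only: of_nat_Suc distrib_right mult_1)
  finally show ?case by (simp only: merged_0)
qed simp

end


section \<open>Counting heavy pairs, and averaging over odd periods\<close>

context simon_transcripts
begin

text \<open>Each heavy index uses up more than 1 of the total weight, and the blocks are
  disjoint.\<close>

lemma card_heavy:
  assumes "l \<in> I"
  shows "real (card {i. i < 2 ^ k \<and> \<not> light_index l i}) \<le> (\<Sum>i<2 ^ k * k * m. q l i)"
proof -
  let ?H = "{i. i < 2 ^ k \<and> \<not> light_index l i}" and ?w = "\<lambda>i. \<Sum>r\<in>blk (k * m) i. q l r"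
  have "real (card ?H) = (\<Sum>i\<in>?H. 1)" by simp
  also have "\<dots> \<le> (\<Sum>i\<in>?H. ?w i)" by (intro sum_mono) (auto simp: light_index_def light_def)
  also have "\<dots> \<le> (\<Sum>i<2 ^ k. ?w i)" using assms q_nonneg by (intro sum_mono2) (auto intro!: sum_nonneg)
  also have "\<dots> = (\<Sum>i<2 ^ k * k * m. q l i)"
    using sum.nat_group[of "q l" "k * m" "2 ^ k"] by (simp add: blk_def mult.assoc)
  finally show ?thesis .
qed

text \<open>A bad \<open>a\<close> is the XOR of two heavy indices.\<close>

lemma card_not_pairwise_light:
  assumes "l \<in> I" "(\<Sum>i<2 ^ k * k * m. q l i) \<le> t"
  shows "real (card {a. a < 2 ^ k \<and> \<not> pairwise_light a l}) \<le> t\<^sup>2"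
proof -
  let ?H = "{i. i < 2 ^ k \<and> \<not> light_index l i}"
  have "{a. a < 2 ^ k \<and> \<not> pairwise_light a l} \<subseteq> (\<lambda>(i, j). Bit_Operations.xor i j) ` (?H \<times> ?H)"
  proof
    fix a assume "a \<in> {a. a < 2 ^ k \<and> \<not> pairwise_light a l}"
    then obtain i where i: "a < 2 ^ k" "i < 2 ^ k" "\<not> light_index l i" "\<not> light_index l (Bit_Operations.xor i a)"
      by (auto simp: pairwise_light_def)
    moreover have "a = Bit_Operations.xor i (Bit_Operations.xor i a)" by (metis xor_eq_iff)
    ultimately show "a \<in> (\<lambda>(i, j). Bit_Operations.xor i j) ` (?H \<times> ?H)"
      using xor_less[OF i(2,1)] by (auto intro!: image_eqI[of _ _ "(i, Bit_Operations.xor i a)"])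
  qed
  then have "card {a. a < 2 ^ k \<and> \<not> pairwise_light a l} \<le> card (?H \<times> ?H)"
    by (intro surj_card_le) auto
  then have "real (card {a. a < 2 ^ k \<and> \<not> pairwise_light a l}) \<le> (real (card ?H))\<^sup>2"
    by (simp only: card_cartesian_product of_nat_le_iff of_nat_power[symmetric] power2_eq_square[symmetric])
  also have "\<dots> \<le> t\<^sup>2" using card_heavy[OF assms(1)] assms(2) by (intro power_mono) auto
  finally show ?thesis .
qed

lemma card_odd_less: "k > 0 \<Longrightarrow> card {a :: nat. a < 2 ^ k \<and> odd a} = 2 ^ (k - 1)"
proof -
  assume "k > 0"
  then have k: "(2 :: nat) ^ k = 2 * 2 ^ (k - 1)" by (metis power_eq_if not_gr0)
  have "{a :: nat. a < 2 ^ k \<and> odd a} = (\<lambda>b. 2 * b + 1) ` {..<2 ^ (k - 1)}"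
    unfolding k by (auto elim!: oddE)
  also have "card \<dots> = 2 ^ (k - 1)" by (subst card_image) (auto simp: inj_on_def)
  finally show ?thesis .
qed

lemma sum_mass_bounds:
  assumes "F \<subseteq> I" "Y \<subseteq> {..<2 ^ k * k}"
  shows "(\<And>X. X \<in> inputs (2 ^ k * k) m Y \<Longrightarrow> (\<Sum>l\<in>F. P l X) \<le> c) \<Longrightarrow> (\<Sum>l\<in>F. mass l Y) \<le> c * count"
    "(\<And>X. X \<in> inputs (2 ^ k * k) m Y \<Longrightarrow> (\<Sum>l\<in>F. P l X) \<ge> c) \<Longrightarrow> (\<Sum>l\<in>F. mass l Y) \<ge> c * count"
proof -
  have eq: "(\<Sum>l\<in>F. mass l Y) = (\<Sum>X\<in>inputs (2 ^ k * k) m Y. \<Sum>l\<in>F. P l X)"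
    unfolding mass_def by (rule sum.swap)
  have c: "c * count = (\<Sum>X\<in>inputs (2 ^ k * k) m Y. c)"
    using card_inputs_eq[OF assms(2) m_pos] by (simp add: count_def)
  show "(\<And>X. X \<in> inputs (2 ^ k * k) m Y \<Longrightarrow> (\<Sum>l\<in>F. P l X) \<le> c) \<Longrightarrow> (\<Sum>l\<in>F. mass l Y) \<le> c * count"
    "(\<And>X. X \<in> inputs (2 ^ k * k) m Y \<Longrightarrow> (\<Sum>l\<in>F. P l X) \<ge> c) \<Longrightarrow> (\<Sum>l\<in>F. mass l Y) \<ge> c * count"
    unfolding eq c by (intro sum_mono; simp)+
qed

text \<open>Double counting over odd periods and leaves in \<open>F\<close>. For each
  \<open>a\<close>, the leaves that are good for \<open>a\<close> carry little mass under a random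
  permutation, since merging hardly changes it. Yet each leaf is bad for at most
  \<open>t\<^sup>2\<close> periods, so small \<open>t\<close> would leave too little mass in
  \<open>F\<close>.\<close>

lemma distinguishing_bound:
  assumes k: "k > 0" and F: "F \<subseteq> I"
    and t: "\<And>l. l \<in> I \<Longrightarrow> (\<Sum>i<2 ^ k * k * m. q l i) \<le> t"
    and zero: "\<And>\<pi> X. \<pi> permutes {..<2 ^ k} \<Longrightarrow> X \<in> inputs (2 ^ k * k) m (code k \<pi>) \<Longrightarrow> (\<Sum>l\<in>F. P l X) \<ge> 2 / 3"
    and odd: "\<And>a \<pi> X. a < 2 ^ k \<Longrightarrow> odd a \<Longrightarrow> \<pi> permutes {..<2 ^ k} \<Longrightarrow>
      X \<in> inputs (2 ^ k * k) m (code k (merged a (2 ^ k) \<pi>)) \<Longrightarrow> (\<Sum>l\<in>F. P l X) \<le> 1 / 3"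
  shows "2 ^ (k - 1) * (1 / 3 - 4 * (2 ^ k * k) * D / 2 ^ m) \<le> t\<^sup>2"
proof -
  let ?O = "{a :: nat. a < 2 ^ k \<and> odd a}"
  define M where "M = count * card perms"
  \<comment> \<open>The relative error of 2 ^ k merges, each costing 2k times
    \<open>flip_error\<close>.\<close>
  define \<epsilon> where "\<epsilon> = 4 * (2 ^ k * k) * D / 2 ^ m"
  define G where "G l = (\<Sum>\<pi>\<in>perms. mass l (code k \<pi>))" for l
  define H where "H a l = (\<Sum>\<pi>\<in>perms. mass l (code k (merged a (2 ^ k) \<pi>)))" for a l
  have codes: "code k z \<subseteq> {..<2 ^ k * k}" for z by (auto simp: code_def)
  have "id \<in> perms" by (simp add: permutes_id)
  then have "card perms > 0" using finite_perms card_gt_0_iff by blast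
  then have M: "M > 0" using card_inputs_pos[of "2 ^ k * k" m] by (simp add: M_def count_def)
  have const: "(\<Sum>\<pi>\<in>perms. c * count) = c * M" for c by (simp add: M_def)
  have G_nonneg: "G l \<ge> 0" for l unfolding G_def by (intro sum_nonneg mass_nonneg)
  have H_nonneg: "H a l \<ge> 0" for a l unfolding H_def by (intro sum_nonneg mass_nonneg)
  have G_le: "(\<Sum>l\<in>F. G l) \<le> M"
  proof -
    have "(\<Sum>l\<in>F. P l X) \<le> 1" for X
      using sum_mono2[OF finite_I F, of "\<lambda>l. P l X"] P_nonneg P_sum[of X] by auto
    then have "(\<Sum>\<pi>\<in>perms. \<Sum>l\<in>F. mass l (code k \<pi>)) \<le> (\<Sum>\<pi>\<in>perms. 1 * count)"
      by (intro sum_mono sum_mass_bounds(1)[OF F codes]) auto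
    then show ?thesis unfolding G_def const by (subst sum.swap) simp
  qed
  have G_ge: "(\<Sum>l\<in>F. G l) \<ge> 2 / 3 * M"
  proof -
    have "(\<Sum>\<pi>\<in>perms. \<Sum>l\<in>F. mass l (code k \<pi>)) \<ge> (\<Sum>\<pi>\<in>perms. 2 / 3 * count)"
      by (intro sum_mono sum_mass_bounds(2)[OF F codes] zero) auto
    then show ?thesis unfolding G_def const by (subst sum.swap) simp
  qed
  have H_le: "(\<Sum>l\<in>F. H a l) \<le> 1 / 3 * M" if "a \<in> ?O" for a
  proof -
    have "(\<Sum>\<pi>\<in>perms. \<Sum>l\<in>F. mass l (code k (merged a (2 ^ k) \<pi>))) \<le> (\<Sum>\<pi>\<in>perms. 1 / 3 * count)"
      using that by (intro sum_mono sum_mass_bounds(1)[OF F codes] odd[of a]) auto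
    then show ?thesis unfolding H_def const by (subst sum.swap) simp
  qed
  have light: "(\<Sum>l\<in>F. of_bool (pairwise_light a l) * G l) \<le> (\<epsilon> + 1 / 3) * M" if "a \<in> ?O" for a
  proof -
    have "(\<Sum>l\<in>F. of_bool (pairwise_light a l) * G l)
        \<le> (\<Sum>l\<in>F. of_bool (pairwise_light a l) * \<bar>G l - H a l\<bar> + H a l)"
      using H_nonneg[of a] by (intro sum_mono) (auto simp: of_bool_def)
    also have "\<dots> \<le> (\<Sum>l\<in>I. of_bool (pairwise_light a l) * \<bar>G l - H a l\<bar>) + (\<Sum>l\<in>F. H a l)"
      unfolding sum.distrib using F finite_I by (intro add_right_mono sum_mono2) auto
    also have "\<dots> \<le> (2 ^ k) * (2 * k * flip_error * card perms) + 1 / 3 * M"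
      using merge_all[of a "2 ^ k"] H_le[OF that] that by (intro add_mono) (auto simp: G_def H_def)
    also have "(2 ^ k) * (2 * k * flip_error * card perms) = \<epsilon> * M"
      by (simp add: flip_error_def M_def \<epsilon>_def)
    finally show ?thesis by (simp add: algebra_simps)
  qed
  define c where "c = real (card ?O)"
  have "c * (\<Sum>l\<in>F. G l) - t\<^sup>2 * (\<Sum>l\<in>F. G l) = (\<Sum>l\<in>F. (c - t\<^sup>2) * G l)"
    by (simp add: left_diff_distrib sum_distrib_left sum_subtractf)
  also have "\<dots> \<le> (\<Sum>l\<in>F. (\<Sum>a\<in>?O. of_bool (pairwise_light a l)) * G l)"
  proof (intro sum_mono mult_right_mono G_nonneg)
    fix l assume "l \<in> F"
    then have l: "l \<in> I" using F by auto
    have split: "{a \<in> ?O. pairwise_light a l} \<union> {a \<in> ?O. \<not> pairwise_light a l} = ?O" by auto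
    have "card ?O \<le> card {a \<in> ?O. pairwise_light a l} + card {a \<in> ?O. \<not> pairwise_light a l}"
      using card_Un_le[of "{a \<in> ?O. pairwise_light a l}" "{a \<in> ?O. \<not> pairwise_light a l}"] unfolding split .
    also have "card {a \<in> ?O. \<not> pairwise_light a l} \<le> card {a. a < 2 ^ k \<and> \<not> pairwise_light a l}"
      by (intro card_mono) auto
    finally have "c - t\<^sup>2 \<le> card {a \<in> ?O. pairwise_light a l}"
      using card_not_pairwise_light[OF l t[OF l]] unfolding c_def by linarith
    also have "\<dots> = (\<Sum>a\<in>{a \<in> ?O. pairwise_light a l}. 1)" by simp
    also have "\<dots> = (\<Sum>a\<in>?O. of_bool (pairwise_light a l))"
      unfolding of_bool_def by (rule sum.inter_filter) simp
    finally show "c - t\<^sup>2 \<le> (\<Sum>a\<in>?O. of_bool (pairwise_light a l))" .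
  qed
  also have "\<dots> = (\<Sum>a\<in>?O. \<Sum>l\<in>F. of_bool (pairwise_light a l) * G l)"
    unfolding sum_distrib_right by (rule sum.swap)
  also have "\<dots> \<le> (\<Sum>a\<in>?O. (\<epsilon> + 1 / 3) * M)" by (intro sum_mono light)
  finally have "c * (\<Sum>l\<in>F. G l) - t\<^sup>2 * (\<Sum>l\<in>F. G l) \<le> c * (\<epsilon> + 1 / 3) * M" by (simp add: c_def)
  \<comment> \<open>The lower bound on the mass of \<open>F\<close> serves the term with
    \<open>c\<close>, the upper bound the subtracted one.\<close>
  moreover have "c * (\<Sum>l\<in>F. G l) \<ge> c * (2 / 3 * M)" using G_ge by (intro mult_left_mono) (auto simp: c_def)
  moreover have "t\<^sup>2 * (\<Sum>l\<in>F. G l) \<le> t\<^sup>2 * M" using G_le by (intro mult_left_mono) auto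
  ultimately have "c * (2 / 3) * M - t\<^sup>2 * M \<le> c * (\<epsilon> + 1 / 3) * M" by simp
  then have "(c * (1 / 3 - \<epsilon>)) * M \<le> t\<^sup>2 * M" by (simp add: algebra_simps)
  then have "c * (1 / 3 - \<epsilon>) \<le> t\<^sup>2" using M by (simp only: mult_le_cancel_right_pos)
  then show ?thesis by (simp only: c_def card_odd_less[OF k] \<epsilon>_def of_nat_power of_nat_numeral)
qed

end


section \<open>Encoding of legal inputs\<close>

lemma block_map_upt:
  assumes "i < n"
  shows "block m i (map f [0..<n * m]) = map f [i * m..<i * m + m]"
proof -
  have "i * m + m \<le> n * m" using mult_right_mono[of "i + 1" n m] assms by simp
  then show ?thesis by (simp add: block_def take_map drop_map take_upt)
qed

lemma foldr_parity: "foldr (\<noteq>) (map (\<lambda>i. i \<in> X) [a..<a + m]) False \<longleftrightarrow> odd (card (X \<inter> {a..<a + m}))"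
proof (induction m arbitrary: a)
  case (Suc m)
  have "{a..<a + Suc m} = insert a {Suc a..<Suc a + m}" by auto
  then have "X \<inter> {a..<a + Suc m} = (if a \<in> X then insert a (X \<inter> {Suc a..<Suc a + m}) else X \<inter> {Suc a..<Suc a + m})"
    by auto
  then have "card (X \<inter> {a..<a + Suc m}) = of_bool (a \<in> X) + card (X \<inter> {Suc a..<Suc a + m})"
    by (simp add: card_insert_if)
  moreover have "[a..<a + Suc m] = a # [Suc a..<Suc a + m]" by (simp add: upt_conv_Cons)
  ultimately show ?case using Suc[of "Suc a"] by simp
qed simp

lemma nat_of_bits_code:
  assumes "i < 2 ^ k" "z i < 2 ^ k"
  shows "nat_of_bits (map (\<lambda>p. p \<in> code k z) [i * k..<i * k + k]) = z i"
proof -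
  have "rev (map (\<lambda>p. p \<in> code k z) [i * k..<i * k + k]) = map (bit (z i)) [0..<k]"
  proof (rule nth_equalityI)
    fix j assume "j < length (rev (map (\<lambda>p. p \<in> code k z) [i * k..<i * k + k]))"
    then have j: "j < k" by simp
    let ?p = "i * k + (k - Suc j)"
    have "?p div k = i" "?p mod k = k - Suc j" using j by (simp_all del: add_diff_assoc diff_add_assoc)
    moreover have "?p < 2 ^ k * k"
      using j mult_right_mono[of "i + 1" "2 ^ k" k] assms(1) by simp
    ultimately show "rev (map (\<lambda>p. p \<in> code k z) [i * k..<i * k + k]) ! j = map (bit (z i)) [0..<k] ! j"
      using j by (simp add: rev_nth code_def)
  qed simp
  then show ?thesis
    using assms(2) by (simp add: nat_of_bits_def horner_sum_bit_eq_take_bit take_bit_nat_eq_self)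
qed

lemma block_compose_code:
  assumes z: "simon_witness k (map z [0..<2 ^ k]) a" and X: "X \<in> inputs (2 ^ k * k) m (code k z)"
  shows "block_compose (2 ^ k * k) m (bool_simon k) (xor_fun m) (bits_of (2 ^ k * k * m) X) = Some (odd a)"
proof -
  let ?n = "2 ^ k * k"
  have blocks: "xor_fun m (block m p (bits_of (?n * m) X)) = Some (p \<in> code k z)" if "p < ?n" for p
    using X that by (simp add: bits_of_def block_map_upt xor_fun_def foldr_parity[simplified] inputs_def blk_def)
  have "z i < 2 ^ k" if "i < 2 ^ k" for i using z that by (simp add: simon_witness_def)
  then have "map (\<lambda>i. nat_of_bits (block k i (map (\<lambda>p. p \<in> code k z) [0..<?n]))) [0..<2 ^ k] = map z [0..<2 ^ k]"
    by (simp add: block_map_upt nat_of_bits_code)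
  then have "bool_simon k (map (\<lambda>p. p \<in> code k z) [0..<?n]) = Some (odd a)"
    unfolding bool_simon_def bool_simon_length_def lsb_simon_def
    by (simp only: simon_eq[OF z] length_map length_upt) (simp add: odd_iff_mod_2_eq_one)
  moreover have "map (\<lambda>p. the (xor_fun m (block m p (bits_of (?n * m) X)))) [0..<?n] = map (\<lambda>p. p \<in> code k z) [0..<?n]"
    using blocks by (intro map_cong) auto
  moreover have "block_compose ?n m (bool_simon k) (xor_fun m) (bits_of (?n * m) X)
      = bool_simon k (map (\<lambda>p. the (xor_fun m (block m p (bits_of (?n * m) X)))) [0..<?n])"
    using blocks by (simp add: block_compose_def) (simp add: bits_of_def)
  ultimately show ?thesis by (simp only:)
qed

text \<open>The full merge maps \<open>j\<close> to the value of \<pi> at the smaller member of its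
  pair; as \<pi> is injective, values agree exactly within pairs.\<close>

lemma simon_witness_merged:
  assumes \<pi>: "\<pi> permutes {..<2 ^ k}" and a: "a < 2 ^ k"
  shows "simon_witness k (map (merged a (2 ^ k) \<pi>) [0..<2 ^ k]) a"
proof -
  let ?r = "\<lambda>j. min j (Bit_Operations.xor j a)"
  have r: "merged a (2 ^ k) \<pi> j = \<pi> (?r j)" if "j < 2 ^ k" for j
    using that by (simp add: merged_def min_less_iff_disj)
  have "merged a (2 ^ k) \<pi> j < 2 ^ k" if "j < 2 ^ k" for j
    using permutes_in_image[OF \<pi>, of "?r j"] that r[OF that] by (simp add: min_less_iff_disj)
  moreover have "merged a (2 ^ k) \<pi> i = merged a (2 ^ k) \<pi> j \<longleftrightarrow> Bit_Operations.xor i j = a"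
    if ij: "i < 2 ^ k" "j < 2 ^ k" "i \<noteq> j" for i j
  proof -
    have "merged a (2 ^ k) \<pi> i = merged a (2 ^ k) \<pi> j \<longleftrightarrow> ?r i = ?r j"
      using r ij(1,2) permutes_inj[OF \<pi>] by (simp add: inj_eq)
    also have "\<dots> \<longleftrightarrow> j = Bit_Operations.xor i a"
    proof
      assume "?r i = ?r j"
      then show "j = Bit_Operations.xor i a" using ij(3) by (metis min_def xor_xor_cancel)
    qed (simp add: min.commute)
    finally show ?thesis by (simp add: xor_eq_iff)
  qed
  ultimately show ?thesis using a by (simp add: simon_witness_def)
qed

lemma simon_witness_permutation:
  assumes "\<pi> permutes {..<2 ^ k}"
  shows "simon_witness k (map \<pi> [0..<2 ^ k]) 0"
proof -
  have "merged 0 p \<pi> = \<pi>" for p by (simp add: merged_def fun_eq_iff)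
  then show ?thesis using simon_witness_merged[OF assms, of 0] by simp
qed


section \<open>Lower bound on the cost of a hybrid tree\<close>

lemma sum_list_nth: "(\<Sum>l\<leftarrow>xs. f l) = (\<Sum>i<length xs. f (xs ! i))" for f :: "'a \<Rightarrow> real"
  by (simp add: sum_list_sum_nth lessThan_atLeast0)

lemma hybrid_cost_bound:
  fixes k m :: nat
  defines "n \<equiv> 2 ^ k * k"
  assumes k: "k > 0" "m > 0" and T: "hybrid_wf (n * m) T" "hybrid_limited 1 T"
    and comp: "hybrid_computes (n * m) T (block_compose n m (bool_simon k) (xor_fun m))"
  shows "2 ^ (k - 1) * (1 / 3 - 4 * n * exp 3 / 2 ^ m) \<le> (real (hybrid_cost T))\<^sup>2"
proof -
  let ?L = "leaves (n * m) T"
  let ?J = "{..<length ?L}"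
  define P where "P l X = (cmod (amplitude (?L ! l) (bits_of (n * m) X)))\<^sup>2" for l X
  define q where "q l = weight (?L ! l)" for l
  \<comment> \<open>Output \<open>False\<close> is correct on permutations, whose period 0 is even,
    and wrong on odd periods.\<close>
  let ?F = "{l \<in> ?J. \<not> label (?L ! l)}"
  have N: "n * m > 0" using k by (simp add: n_def)
  \<comment> \<open>Leaves are indexed by their place in the list, because distinct leaves may
    coincide as triples.\<close>
  interpret simon_transcripts k m ?J P q "exp 3"
  proof
    show "(\<Sum>l\<in>?J. P l X) \<le> 1" for X
      using sum_leaves_le_1[OF T N, of X] by (simp add: P_def sum_list_nth)
    show "q l i \<ge> 0" if "l \<in> ?J" for l i using that by (simp add: q_def weight_leaves_nonneg[OF nth_mem])
    show "(\<Sum>l\<in>?J. of_bool ((\<Sum>i\<in>S. q l i) \<le> 1) * \<bar>\<Sum>Z\<in>Pow S. P l (X \<union> Z) * (-1) ^ card Z\<bar>) \<le> exp 3"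
      if S: "S \<subseteq> {..<2 ^ k * k * m}" "X \<inter> S = {}" for S X
    proof -
      have "\<bar>\<Sum>Z\<in>Pow S. P l (X \<union> Z) * (-1) ^ card Z\<bar>
          = cmod (\<Sum>Z\<in>Pow S. (cmod (amplitude (?L ! l) (bits_of (n * m) (X \<union> Z))))\<^sup>2 * walsh S Z)" for l
      proof -
        have "(\<Sum>Z\<in>Pow S. (cmod (amplitude (?L ! l) (bits_of (n * m) (X \<union> Z))))\<^sup>2 * walsh S Z)
            = complex_of_real (\<Sum>Z\<in>Pow S. P l (X \<union> Z) * (-1) ^ card Z)"
          unfolding of_real_sum by (intro sum.cong refl) (auto simp: P_def walsh_def Int_absorb1)
        then show ?thesis by (simp only: norm_of_real)
      qed
      then show ?thesis
        using sum_bias_le[OF T N, of S X] S by (simp add: sum_list_nth q_def n_def)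
    qed
  qed (use k in \<open>auto simp: P_def\<close>)
  have correct: "hybrid_output_prob (n * m) (bits_of (n * m) X) (odd a) T \<ge> 2 / 3"
    if "simon_witness k (map z [0..<2 ^ k]) a" "X \<in> inputs (2 ^ k * k) m (code k z)" for z a X
    using comp block_compose_code[OF that] unfolding hybrid_computes_def n_def by blast
  have False_prob: "hybrid_output_prob (n * m) (bits_of (n * m) X) False T = (\<Sum>l\<in>?F. P l X)" for X
  proof -
    have "(\<Sum>l\<in>?F. P l X) = (\<Sum>l\<in>?J. if \<not> label (?L ! l) then P l X else 0)"
      by (rule sum.inter_filter) simp
    also have "\<dots> = hybrid_output_prob (n * m) (bits_of (n * m) X) False T"
      unfolding hybrid_output_prob_leaves sum_list_nth P_def by (intro sum.cong) auto
    finally show ?thesis ..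
  qed
  have total: "hybrid_output_prob (n * m) (bits_of (n * m) X) True T
      + hybrid_output_prob (n * m) (bits_of (n * m) X) False T = (\<Sum>l\<in>?J. P l X)" for X
    unfolding hybrid_output_prob_leaves sum_list_nth P_def sum.distrib[symmetric]
    by (intro sum.cong) auto
  have "2 ^ (k - 1) * (1 / 3 - 4 * (2 ^ k * k) * exp 3 / 2 ^ m) \<le> (real (hybrid_cost T))\<^sup>2"
  proof (rule distinguishing_bound)
    show "(\<Sum>i<2 ^ k * k * m. q l i) \<le> real (hybrid_cost T)" if "l \<in> ?J" for l
      using sum_weight_le_cost[OF T(1) N, of "?L ! l"] that by (simp add: q_def n_def)
    show "(\<Sum>l\<in>?F. P l X) \<ge> 2 / 3" if "\<pi> permutes {..<2 ^ k}" "X \<in> inputs (2 ^ k * k) m (code k \<pi>)" for \<pi> X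
      using correct[OF simon_witness_permutation[OF that(1)] that(2)] False_prob by simp
    show "(\<Sum>l\<in>?F. P l X) \<le> 1 / 3"
      if "a < 2 ^ k" "odd a" "\<pi> permutes {..<2 ^ k}" "X \<in> inputs (2 ^ k * k) m (code k (merged a (2 ^ k) \<pi>))" for a \<pi> X
      using correct[OF simon_witness_merged[OF that(3,1)] that(4)] that(2) total[of X] False_prob[of X] P_sum[of X] by simp
  qed (use k in auto)
  then show ?thesis by (simp only: n_def of_nat_mult of_nat_power of_nat_numeral)
qed

lemma soft_bound:
  fixes k m :: nat
  defines "n \<equiv> bool_simon_length k"
  assumes k: "k \<ge> 10" and m: "2 * log 2 n \<le> m"
  shows "sqrt n / log 2 (sqrt n) \<le>
    6 * real (hybrid_complexity 1 (n * m) (block_compose n m (bool_simon k) (xor_fun m)))"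
proof -
  have n: "n = 2 ^ k * k" by (simp add: n_def bool_simon_length_def)
  have "(2 :: nat) ^ 10 \<le> 2 ^ k" using k by (intro power_increasing) auto
  then have "2 ^ 10 * 10 \<le> n" unfolding n using k by (intro mult_mono) auto
  then have n_large: "real n \<ge> 10240" by simp
  have "log 2 n > 0" using n_large by simp
  then have m_pos: "m > 0" using m by (cases m) auto
  obtain T where T: "hybrid_wf (n * m) T" "hybrid_limited 1 T"
    "hybrid_computes (n * m) T (block_compose n m (bool_simon k) (xor_fun m))"
    "hybrid_cost T = hybrid_complexity 1 (n * m) (block_compose n m (bool_simon k) (xor_fun m))"
    by (rule hybrid_complexity_attained[of "block_compose n m (bool_simon k) (xor_fun m)" "n * m" 1])
      (auto simp: block_compose_def split: if_splits)
  let ?t = "real (hybrid_cost T)"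
  have "real n * real n = 2 powr (log 2 n + log 2 n)" using n_large by (subst powr_add) simp
  also have "\<dots> \<le> 2 powr m" using m by (intro powr_mono) auto
  also have "\<dots> = 2 ^ m" by (simp add: powr_realpow)
  finally have nn: "real n * real n \<le> 2 ^ m" .
  have "exp (3 :: real) = exp 1 ^ 3" by (simp flip: exp_of_nat_mult)
  also have "\<dots> \<le> 3 ^ 3" by (intro power_mono exp_le) auto
  \<comment> \<open>The choice of \<open>m\<close> gives 2 ^ m at least \<open>n\<close> squared.
    With exp 3 at most 27 and \<open>n\<close> at least 10240, the error stays below 1/12 and leaves
    1/4 of the gap 1/3.\<close>
  finally have "4 * real n * exp 3 \<le> real n * 108"
    using mult_left_mono[of "exp 3" 27 "real n"] by simp
  also have "\<dots> \<le> real n * (real n / 12)" using n_large by (intro mult_left_mono) auto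
  also have "\<dots> \<le> 2 ^ m / 12" using nn by simp
  finally have "4 * real n * exp 3 / 2 ^ m \<le> 1 / 12" by (simp add: divide_le_eq)
  then have "1 / 4 \<le> 1 / 3 - 4 * real n * exp 3 / 2 ^ m" by linarith
  then have "2 ^ (k - 1) * (1 / 4) \<le> 2 ^ (k - 1) * (1 / 3 - 4 * real n * exp 3 / 2 ^ m)"
    by (rule mult_left_mono) simp
  also have "\<dots> \<le> ?t\<^sup>2"
    using hybrid_cost_bound[of k m T] T(1-3) k m_pos unfolding n by simp
  also have "2 ^ (k - 1) * (1 / 4) = (2 :: real) ^ k / 8" using k by (cases k) auto
  finally have "2 ^ k \<le> 8 * ?t\<^sup>2" by simp
  \<comment> \<open>Rounding 8 up to the square 9.\<close>
  also have "\<dots> \<le> (3 * ?t)\<^sup>2" by (simp add: power_mult_distrib)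
  finally have root: "sqrt (2 ^ k) \<le> 3 * ?t" by (intro real_le_lsqrt) auto
  have "log 2 (sqrt n) = log 2 n / 2"
    using n_large by (simp add: log_def ln_sqrt)
  moreover have "log 2 n = k + log 2 k"
    using k by (simp add: n log_mult log_nat_power)
  moreover have "log 2 k \<ge> 0" using k by simp
  ultimately have log: "log 2 (sqrt n) \<ge> k / 2" by simp
  have "sqrt k \<le> k" using k by (intro real_le_lsqrt) (auto simp: power2_eq_square)
  \<comment> \<open>The bound just obtained lacks the factor \<open>sqrt k\<close> of
    \<open>sqrt n\<close>; one logarithm, at least \<open>k / 2\<close>, makes up for it.\<close>
  have "sqrt n / log 2 (sqrt n) \<le> sqrt n / (k / 2)"
    using log k by (intro divide_left_mono) auto
  also have "\<dots> = 2 * sqrt (2 ^ k) * (sqrt k / k)" by (simp add: n real_sqrt_mult)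
  also have "\<dots> \<le> 2 * sqrt (2 ^ k) * 1"
    using \<open>sqrt k \<le> k\<close> k by (intro mult_left_mono) auto
  also have "\<dots> \<le> 6 * ?t" using root by simp
  finally show ?thesis using T(4) by simp
qed

theorem theorem3:
  shows "\<exists>C::real. C > 0 \<and>
    (\<lambda>k. let n = bool_simon_length k; m = nat \<lceil>C * log 2 (real n)\<rceil> in
       real (hybrid_complexity 1 (n * m) (block_compose n m (bool_simon k) (xor_fun m))))
    \<in> soft_bigomega (\<lambda>k. sqrt (real (bool_simon_length k)))"
\<comment> \<open>\<open>C = 2\<close> meets the requirement of \<open>soft_bound\<close> on
  \<open>m\<close>, and the first power of the logarithm suffices.\<close>
proof (intro exI[of _ 2] conjI)
  let ?f = "\<lambda>k. let n = bool_simon_length k; m = nat \<lceil>2 * log 2 (real n)\<rceil> in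
       real (hybrid_complexity 1 (n * m) (block_compose n m (bool_simon k) (xor_fun m)))"
  let ?g = "\<lambda>k. sqrt (real (bool_simon_length k))"
  have "\<forall>\<^sub>F k in sequentially. norm (?g k / log 2 (?g k) ^ 1) \<le> 6 * norm (?f k)"
    using eventually_ge_at_top[of 10]
  proof eventually_elim
    case (elim k)
    let ?n = "bool_simon_length k"
    have "?n > 0" using elim by (simp add: bool_simon_length_def)
    then have "real ?n \<ge> 1" by simp
    then have "norm (?g k / log 2 (?g k) ^ 1) = ?g k / log 2 (?g k)" by simp
    also have "\<dots> \<le> 6 * ?f k"
      unfolding Let_def by (rule soft_bound[OF elim]) linarith
    finally show ?case by (simp add: Let_def)
  qed
  then have "(\<lambda>k. ?g k / log 2 (?g k) ^ 1) \<in> O(?f)" by (rule bigoI)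
  then have "?f \<in> \<Omega>(\<lambda>k. ?g k / log 2 (?g k) ^ 1)" by (simp only: bigomega_iff_bigo)
  then show "?f \<in> soft_bigomega ?g" unfolding soft_bigomega_def by blast
qed simp

end
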